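(* Let $\mathcal I^c$ be a non-null intricacy and let $d\ge2$ be an integer. (1) The following limits exist, the second one for all $x\in[0,1]$: $$\mathcal I^c(d):=\lim_{N\to\infty}\frac{\mathcal I^c(d,N)}{N},\qquad \mathcal I^c(d,x):=\lim_{N\to\infty}\frac{\mathcal I^c(d,N,x)}{N},$$ and, for all $x\in[0,1]$, we have the bounds $$\min\{x,1-x\}\,\kappa_c\ \le\ \frac{\mathcal I^c(d,x)}{\log d}\ \le\ \frac{\mathcal I^c(d)}{\log d}\ \le\ \frac12,$$ where $\kappa_c:=2\int_{[0,1]}y(1-y)\,\lambda_c(dy)>0$. (2) Let $(\delta_N)_{N\ge1}$ be any sequence of non-negative numbers converging to zero and let $x\in[0,1]$. Then $$\mathcal I^c(d,x)=\lim_{N\to\infty}\frac1N\,\sup\left\{\mathcal I^c(X):\ X\in\mathcal X(d,N),\ \left|\frac{\mathrm H(X)}{N\log d}-x\right|\le\delta_N\right\}.$$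
   Context: Notation. $\mathbb N^*=\{1,2,\dots\}$; $0^0=1$. For a random variable $X$ with values in a finite set, the entropy is $\mathrm H(X)=-\sum_x \mathbb P(X=x)\log \mathbb P(X=x)$ (with $0\log 0=0$), and for two such variables on the same probability space $\mathrm{MI}(X,Y)=\mathrm H(X)+\mathrm H(Y)-\mathrm H(X,Y)$ is their mutual information. Systems. Let $d\ge2$ be an integer. For a finite set $I\subset\mathbb N^*$, a system is a family $X=(X_i)_{i\in I}$ of random variables on a common probability space, each with values in $\{0,\dots,d-1\}$. $\mathcal X(d,I)$ is the set of such systems, $\mathcal M(d,I)$ the set of their laws (all probability measures on $\{0,\dots,d-1\}^I$); $\mathcal X(d,N):=\mathcal X(d,\{1,\dots,N\})$, $\mathcal M(d,N):=\mathcal M(d,\{1,\dots,N\})$. For $S\subset I$: $X_S:=(X_i)_{i\in S}$ and $S^c:=I\setminus S$. A system of coefficients is a family of real numbers $c=(c^I_S)$, indexed by all finite $I\subset\mathbb N^*$ and all $S\subset I$, with $c^I_S\ge0$, $\sum_{S\subset I}c^I_S=1$ and $c^I_{S^c}=c^I_S$. The associated mutual information functional is $\mathcal I^c(X):=\sum_{S\subset I}c^I_S\,\mathrm{MI}(X_S,X_{S^c})$ for $X\in\mathcal X(d,I)$, with the convention $\mathrm{MI}(X_\emptyset,X_I)=\mathrm{MI}(X_I,X_\emptyset)=0$. If $X$ has law $\mu$, write $\mathcal I^c(\mu)=\mathcal I^c(X)$ and $\mathrm H(\mu)=\mathrm H(X)$. $\mathcal I^c$ is non-null if some coefficient $c^I_S$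 with $S\notin\{\emptyset,I\}$ is nonzero. $\mathcal I^c$ is exchangeable if for all finite $I,J\subset\mathbb N^*$ and every bijection $\phi:I\to J$, $\mathcal I^c(X)=\mathcal I^c(Y)$ whenever $X=(X_i)_{i\in I}$ and $Y=(X_{\phi^{-1}(j)})_{j\in J}$. $\mathcal I^c$ is weakly additive if $\mathcal I^c(X,Y)=\mathcal I^c(X)+\mathcal I^c(Y)$ for any two independent systems $X=(X_i)_{i\in I}$, $Y=(Y_j)_{j\in J}$ with disjoint index sets, where $(X,Y)$ is the joint system indexed by $I\sqcup J$. An intricacy is a mutual information functional that is exchangeable and weakly additive. To every intricacy $\mathcal I^c$ is associated the unique symmetric (i.e. invariant under $x\mapsto 1-x$) probability measure $\lambda_c$ on $[0,1]$ such that $c^I_S=\int_{[0,1]}x^{|S|}(1-x)^{|I|-|S|}\lambda_c(dx)$ for all finite $I\subset\mathbb N^*$ and $S\subset I$. Define $\mathcal I^c(d,N):=\sup\{\mathcal I^c(\mu):\mu\in\mathcal M(d,N)\}$ and, for $x\in[0,1]$, $\mathcal I^c(d,N,x):=\sup\{\mathcal I^c(\mu):\mu\in\mathcal M(d,N),\ \mathrm H(\mu)=xN\log d\}$. *)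

theory Defs
  imports "HOL-Probability.Probability"
begin

definition shannon_entropy :: "'a measure \<Rightarrow> ('a \<Rightarrow> 'b) \<Rightarrow> real" where
  "shannon_entropy M X =
     - (\<Sum>x\<in>X ` space M. measure M (X -` {x} \<inter> space M) * ln (measure M (X -` {x} \<inter> space M)))"

definition mutual_info :: "'a measure \<Rightarrow> ('a \<Rightarrow> 'b) \<Rightarrow> ('a \<Rightarrow> 'c) \<Rightarrow> real" where
  "mutual_info M X Y =
     shannon_entropy M X + shannon_entropy M Y - shannon_entropy M (\<lambda>\<omega>. (X \<omega>, Y \<omega>))"

lemma shannon_entropy_inj:
  assumes "inj_on f (X ` space M)"
  shows "shannon_entropy M (\<lambda>\<omega>. f (X \<omega>)) = shannon_entropy M X"
proof -
  have "(\<lambda>\<omega>. f (X \<omega>)) -` {f x} \<inter> space M = X -` {x} \<inter> space M" if "x \<in> X ` space M" for x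
    using assms that by (auto dest: inj_onD)
  moreover have "(\<lambda>\<omega>. f (X \<omega>)) ` space M = f ` (X ` space M)" by auto
  ultimately show ?thesis
    using assms unfolding shannon_entropy_def by (simp add: sum.reindex)
qed

text \<open>For finite-valued random variables these are the entropy and the mutual information of
  the library, with natural logarithms.\<close>

lemma shannon_entropy_eq_entropy:
  assumes "prob_space M" and X: "simple_function M X"
  shows "shannon_entropy M X = prob_space.entropy M (exp 1) (count_space (X ` space M)) X"
proof -
  interpret prob_space M by fact
  interpret information_space M "exp 1" by unfold_locales simp
  have "simple_distributed M X (\<lambda>x. measure M (X -` {x} \<inter> space M))"
    using X by (rule simple_distributedI) (auto simp: measure_nonneg)
  from entropy_simple_distributed[OF this] show ?thesis
    by (simp add: shannon_entropy_def log_def)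
qed

lemma mutual_info_eq_mutual_information:
  assumes "prob_space M" and X: "simple_function M X" and Y: "simple_function M Y"
  shows "mutual_info M X Y =
    prob_space.mutual_information M (exp 1) (count_space (X ` space M)) (count_space (Y ` space M)) X Y"
proof -
  interpret prob_space M by fact
  interpret information_space M "exp 1" by unfold_locales simp
  have XY: "simple_function M (\<lambda>\<omega>. (X \<omega>, Y \<omega>))" and YX: "simple_function M (\<lambda>\<omega>. (Y \<omega>, X \<omega>))"
    using X Y by (auto intro: simple_function_Pair)
  have "shannon_entropy M (\<lambda>\<omega>. prod.swap (X \<omega>, Y \<omega>)) = shannon_entropy M (\<lambda>\<omega>. (X \<omega>, Y \<omega>))"
    by (rule shannon_entropy_inj) (auto simp: inj_on_def)
  note comm = this[unfolded prod.swap_def fst_conv snd_conv shannon_entropy_eq_entropy[OF assms(1) XY]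
    shannon_entropy_eq_entropy[OF assms(1) YX]]
  show ?thesis
    unfolding mutual_info_def shannon_entropy_eq_entropy[OF assms(1) X]
      shannon_entropy_eq_entropy[OF assms(1) Y] shannon_entropy_eq_entropy[OF assms(1) XY]
    using mutual_information_eq_entropy_conditional_entropy[OF X Y]
      entropy_chain_rule[OF Y X] comm
    by simp
qed

text \<open>A system is a pair of a probability space \<open>M\<close> and a family \<open>X\<close> of random variables on it;
  only the values \<open>X i\<close> with \<open>i \<in> I\<close> matter.\<close>

definition system :: "nat \<Rightarrow> nat set \<Rightarrow> 'a measure \<Rightarrow> (nat \<Rightarrow> 'a \<Rightarrow> nat) \<Rightarrow> bool" where
  "system d I M X \<longleftrightarrow> prob_space M \<and> (\<forall>i\<in>I. X i \<in> measurable M (count_space {..<d}))"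

definition subsystem :: "(nat \<Rightarrow> 'a \<Rightarrow> nat) \<Rightarrow> nat set \<Rightarrow> 'a \<Rightarrow> nat \<Rightarrow> nat" where
  "subsystem X S = (\<lambda>\<omega>. \<lambda>i\<in>S. X i \<omega>)"

definition configurations :: "nat \<Rightarrow> nat set \<Rightarrow> (nat \<Rightarrow> nat) measure" where
  "configurations d I = count_space (I \<rightarrow>\<^sub>E {..<d})"

definition laws :: "nat \<Rightarrow> nat set \<Rightarrow> (nat \<Rightarrow> nat) measure set" where
  "laws d I = {\<mu>. prob_space \<mu> \<and> sets \<mu> = sets (configurations d I)}"

text \<open>A set of systems cannot range over the probability spaces of all types. Since the
  type of configurations carries the coordinate system of every law, it is taken as the type of
  sample points; lemma \<open>mi_functional_eq_law\<close> below shows that nothing is lost.\<close>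

definition systems ::
    "nat \<Rightarrow> nat set \<Rightarrow> ((nat \<Rightarrow> nat) measure \<times> (nat \<Rightarrow> (nat \<Rightarrow> nat) \<Rightarrow> nat)) set" where
  "systems d I = {(M, X). system d I M X}"

definition finite_index_set :: "nat set \<Rightarrow> bool" where
  "finite_index_set I \<longleftrightarrow> finite I \<and> 0 \<notin> I"

definition coefficient_system :: "(nat set \<Rightarrow> nat set \<Rightarrow> real) \<Rightarrow> bool" where
  "coefficient_system c \<longleftrightarrow>
     (\<forall>I. finite_index_set I \<longrightarrow>
        (\<forall>S. S \<subseteq> I \<longrightarrow> c I S \<ge> 0 \<and> c I (I - S) = c I S) \<and> (\<Sum>S\<in>Pow I. c I S) = 1)"

text \<open>The terms \<open>S = {}\<close> and \<open>S = I\<close> are zero by lemma \<open>mutual_info_subsystem_empty\<close> below,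
  so the convention for them needs no separate clause.\<close>

definition mi_functional ::
    "(nat set \<Rightarrow> nat set \<Rightarrow> real) \<Rightarrow> nat set \<Rightarrow> 'a measure \<Rightarrow> (nat \<Rightarrow> 'a \<Rightarrow> nat) \<Rightarrow> real" where
  "mi_functional c I M X =
     (\<Sum>S\<in>Pow I. c I S * mutual_info M (subsystem X S) (subsystem X (I - S)))"

definition system_entropy :: "nat set \<Rightarrow> 'a measure \<Rightarrow> (nat \<Rightarrow> 'a \<Rightarrow> nat) \<Rightarrow> real" where
  "system_entropy I M X = shannon_entropy M (subsystem X I)"

definition coords :: "nat \<Rightarrow> (nat \<Rightarrow> nat) \<Rightarrow> nat" where
  "coords i x = x i"

definition mi_functional_law ::
    "(nat set \<Rightarrow> nat set \<Rightarrow> real) \<Rightarrow> nat set \<Rightarrow> (nat \<Rightarrow> nat) measure \<Rightarrow> real" where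
  "mi_functional_law c I \<mu> = mi_functional c I \<mu> coords"

definition entropy_law :: "nat set \<Rightarrow> (nat \<Rightarrow> nat) measure \<Rightarrow> real" where
  "entropy_law I \<mu> = system_entropy I \<mu> coords"

definition non_null :: "(nat set \<Rightarrow> nat set \<Rightarrow> real) \<Rightarrow> bool" where
  "non_null c \<longleftrightarrow> (\<exists>I S. finite_index_set I \<and> S \<subseteq> I \<and> S \<noteq> {} \<and> S \<noteq> I \<and> c I S \<noteq> 0)"

definition exchangeable :: "(nat set \<Rightarrow> nat set \<Rightarrow> real) \<Rightarrow> bool" where
  "exchangeable c \<longleftrightarrow>
     (\<forall>d\<ge>2. \<forall>I J \<phi>. finite_index_set I \<longrightarrow> finite_index_set J \<longrightarrow> bij_betw \<phi> I J \<longrightarrow>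
        (\<forall>(M, X)\<in>systems d I.
           mi_functional c I M X = mi_functional c J M (\<lambda>j. X (inv_into I \<phi> j))))"

definition weakly_additive :: "(nat set \<Rightarrow> nat set \<Rightarrow> real) \<Rightarrow> bool" where
  "weakly_additive c \<longleftrightarrow>
     (\<forall>d\<ge>2. \<forall>I J. finite_index_set I \<longrightarrow> finite_index_set J \<longrightarrow> I \<inter> J = {} \<longrightarrow>
        (\<forall>M X Y. (M, X) \<in> systems d I \<longrightarrow> (M, Y) \<in> systems d J \<longrightarrow>
           prob_space.indep_var M (configurations d I) (subsystem X I)
             (configurations d J) (subsystem Y J) \<longrightarrow>
           mi_functional c (I \<union> J) M (\<lambda>i. if i \<in> I then X i else Y i) =
             mi_functional c I M X + mi_functional c J M Y))"

definition intricacy :: "(nat set \<Rightarrow> nat set \<Rightarrow> real) \<Rightarrow> bool" where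
  "intricacy c \<longleftrightarrow> coefficient_system c \<and> exchangeable c \<and> weakly_additive c"

definition represents :: "real measure \<Rightarrow> (nat set \<Rightarrow> nat set \<Rightarrow> real) \<Rightarrow> bool" where
  "represents \<nu> c \<longleftrightarrow>
     prob_space \<nu> \<and> sets \<nu> = sets (restrict_space borel {0..1}) \<and>
     distr \<nu> \<nu> (\<lambda>x. 1 - x) = \<nu> \<and>
     (\<forall>I S. finite_index_set I \<longrightarrow> S \<subseteq> I \<longrightarrow>
        c I S = (\<integral>x. x ^ card S * (1 - x) ^ (card I - card S) \<partial>\<nu>))"

definition intricacy_measure :: "(nat set \<Rightarrow> nat set \<Rightarrow> real) \<Rightarrow> real measure" where
  "intricacy_measure c = (THE \<nu>. represents \<nu> c)"

definition kappa :: "(nat set \<Rightarrow> nat set \<Rightarrow> real) \<Rightarrow> real" where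
  "kappa c = 2 * (\<integral>y. y * (1 - y) \<partial>intricacy_measure c)"

definition max_intricacy :: "(nat set \<Rightarrow> nat set \<Rightarrow> real) \<Rightarrow> nat \<Rightarrow> nat \<Rightarrow> real" where
  "max_intricacy c d N = (SUP \<mu>\<in>laws d {1..N}. mi_functional_law c {1..N} \<mu>)"

definition max_intricacy_at ::
    "(nat set \<Rightarrow> nat set \<Rightarrow> real) \<Rightarrow> nat \<Rightarrow> nat \<Rightarrow> real \<Rightarrow> real" where
  "max_intricacy_at c d N x =
     (SUP \<mu>\<in>{\<mu>\<in>laws d {1..N}. entropy_law {1..N} \<mu> = x * real N * ln (real d)}.
        mi_functional_law c {1..N} \<mu>)"

definition max_intricacy_near ::
    "(nat set \<Rightarrow> nat set \<Rightarrow> real) \<Rightarrow> nat \<Rightarrow> nat \<Rightarrow> real \<Rightarrow> real \<Rightarrow> real" where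
  "max_intricacy_near c d N x \<delta> =
     (SUP (M, X)\<in>{(M, X)\<in>systems d {1..N}.
          \<bar>system_entropy {1..N} M X / (real N * ln (real d)) - x\<bar> \<le> \<delta>}.
        mi_functional c {1..N} M X)"

definition limit_intricacy :: "(nat set \<Rightarrow> nat set \<Rightarrow> real) \<Rightarrow> nat \<Rightarrow> real" where
  "limit_intricacy c d = lim (\<lambda>N. max_intricacy c d N / real N)"

definition limit_intricacy_at :: "(nat set \<Rightarrow> nat set \<Rightarrow> real) \<Rightarrow> nat \<Rightarrow> real \<Rightarrow> real" where
  "limit_intricacy_at c d x = lim (\<lambda>N. max_intricacy_at c d N x / real N)"

lemma mutual_info_subsystem_empty:
  assumes "prob_space M"
  shows "mutual_info M (subsystem X {}) Y = 0" "mutual_info M Y (subsystem X {}) = 0"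
proof -
  interpret prob_space M by fact
  have e: "subsystem X {} = (\<lambda>\<omega>. (\<lambda>_. undefined))"
    by (auto simp: subsystem_def restrict_def fun_eq_iff)
  have "subsystem X {} ` space M = {\<lambda>_. undefined}"
    using not_empty by (auto simp: e)
  then have "shannon_entropy M (subsystem X {}) = 0"
    by (simp add: shannon_entropy_def e prob_space)
  moreover have "shannon_entropy M (\<lambda>\<omega>. ((\<lambda>_. undefined) :: nat \<Rightarrow> nat, Y \<omega>)) = shannon_entropy M Y"
    "shannon_entropy M (\<lambda>\<omega>. (Y \<omega>, (\<lambda>_. undefined) :: nat \<Rightarrow> nat)) = shannon_entropy M Y"
    by (rule shannon_entropy_inj; simp add: inj_on_def)+
  ultimately show "mutual_info M (subsystem X {}) Y = 0" "mutual_info M Y (subsystem X {}) = 0"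
    unfolding mutual_info_def by (simp_all add: e)
qed

lemma subsystem_measurable:
  assumes "finite I" "system d I M X"
  shows "subsystem X I \<in> measurable M (configurations d I)"
proof -
  have "subsystem X I \<in> measurable M (PiM I (\<lambda>_. count_space {..<d}))"
    unfolding subsystem_def using assms by (intro measurable_restrict) (auto simp: system_def)
  moreover have "PiM I (\<lambda>_. count_space {..<d}) = configurations d I"
    unfolding configurations_def using assms by (intro count_space_PiM_finite) auto
  ultimately show ?thesis by simp
qed

lemma law_in_laws:
  assumes "finite I" "system d I M X"
  shows "distr M (configurations d I) (subsystem X I) \<in> laws d I"
  using subsystem_measurable[OF assms] assms
  by (auto simp: laws_def system_def intro!: prob_space.prob_space_distr)

lemma shannon_entropy_distr:
  assumes T: "T \<in> measurable M (count_space A)" and A: "finite A"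
  shows "shannon_entropy (distr M (count_space A) T) f = shannon_entropy M (\<lambda>\<omega>. f (T \<omega>))"
proof -
  let ?N = "distr M (count_space A) T"
  have TA: "T ` space M \<subseteq> A" using measurable_space[OF T] by auto
  have m: "measure ?N (f -` {y} \<inter> space ?N) = measure M ((\<lambda>\<omega>. f (T \<omega>)) -` {y} \<inter> space M)" for y
  proof -
    have "measure ?N (f -` {y} \<inter> A) = measure M (T -` (f -` {y} \<inter> A) \<inter> space M)"
      using T by (intro measure_distr) auto
    also have "T -` (f -` {y} \<inter> A) \<inter> space M = (\<lambda>\<omega>. f (T \<omega>)) -` {y} \<inter> space M"
      using TA by auto
    finally show ?thesis by simp
  qed
  have z: "measure M ((\<lambda>\<omega>. f (T \<omega>)) -` {y} \<inter> space M) = 0" if "y \<notin> (\<lambda>\<omega>. f (T \<omega>)) ` space M" for y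
  proof -
    have "(\<lambda>\<omega>. f (T \<omega>)) -` {y} \<inter> space M = {}" using that by auto
    then show ?thesis by (simp only: measure_empty)
  qed
  have "(\<Sum>y\<in>f ` A. measure M ((\<lambda>\<omega>. f (T \<omega>)) -` {y} \<inter> space M) * ln (measure M ((\<lambda>\<omega>. f (T \<omega>)) -` {y} \<inter> space M)))
    = (\<Sum>y\<in>(\<lambda>\<omega>. f (T \<omega>)) ` space M. measure M ((\<lambda>\<omega>. f (T \<omega>)) -` {y} \<inter> space M) * ln (measure M ((\<lambda>\<omega>. f (T \<omega>)) -` {y} \<inter> space M)))"
    using TA A z by (intro sum.mono_neutral_right) auto
  then show ?thesis
    unfolding shannon_entropy_def m by simp
qed

lemma subsystem_coords_subsystem:
  "S \<subseteq> I \<Longrightarrow> subsystem coords S (subsystem X I \<omega>) = subsystem X S \<omega>"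
  by (auto simp: subsystem_def coords_def fun_eq_iff)

lemma mi_functional_eq_law:
  assumes I: "finite I" and X: "system d I M X"
  shows "mi_functional_law c I (distr M (configurations d I) (subsystem X I)) = mi_functional c I M X"
    and "entropy_law I (distr M (configurations d I) (subsystem X I)) = system_entropy I M X"
proof -
  have fin: "finite (I \<rightarrow>\<^sub>E {..<d})" using I by (intro finite_PiE) auto
  note T = subsystem_measurable[OF I X, unfolded configurations_def]
  show "mi_functional_law c I (distr M (configurations d I) (subsystem X I)) = mi_functional c I M X"
    unfolding mi_functional_law_def mi_functional_def mutual_info_def configurations_def
      shannon_entropy_distr[OF T fin]
    by (intro sum.cong refl) (auto simp: subsystem_coords_subsystem)
  show "entropy_law I (distr M (configurations d I) (subsystem X I)) = system_entropy I M X"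
    unfolding entropy_law_def system_entropy_def configurations_def shannon_entropy_distr[OF T fin]
    by (simp add: subsystem_coords_subsystem)
qed

end

theory Submission
  imports Defs
begin

text \<open>Concatenating two independent systems adds their entropies and, by weak additivity together with
exchangeability, their intricacies (\<open>concatenate_laws\<close>). Hence
\<open>N \<mapsto> max_intricacy c d N\<close> and, for fixed \<open>x\<close>,
\<open>N \<mapsto> max_intricacy_at c d N x\<close> are superadditive: if both pieces have entropy
\<open>x\<close> per symbol, measured in units of \<open>ln d\<close>, so does the whole. By Fekete's lemma
(\<open>superadditive_limit\<close>) the averages converge, and the limit is an upper bound for every
average. This second half of Fekete's lemma gives two of the claims almost for free.

For the lower bound it suffices to look at two coordinates. Take \<open>X\<^sub>1 = X\<^sub>2\<close> of entropy
\<open>2 x ln d\<close> when \<open>x \<le> 1/2\<close>; when \<open>x > 1/2\<close> take \<open>X\<^sub>1\<close> uniform and \<open>X\<^sub>2 = X\<^sub>1 + Z\<close> modulo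
\<open>d\<close> with independent noise \<open>Z\<close> of entropy \<open>(2 x - 1) ln d\<close>. In both cases the pair has entropy
\<open>2 x ln d\<close> and mutual information \<open>2 min x (1 - x) ln d\<close> (\<open>two_coordinate_law\<close>), and the
intricacy of a pair is \<open>kappa c\<close> times its mutual information. The upper bound \<open>1/2\<close> holds
because the mutual information of complementary subsystems is at most the smaller of their
entropies, hence at most half of the total number of symbols times \<open>ln d\<close>.

For the second part, let a system on \<open>N\<close> coordinates have entropy within \<open>\<delta> N ln d\<close> of
\<open>x N ln d\<close>. If \<open>0 < x < 1\<close>, appending \<open>m\<close> independent coordinates of suitable entropy makes the
total exactly \<open>x (N + m) ln d\<close>, as soon as \<open>\<delta> N \<le> min x (1 - x) m\<close>. Its intricacy does not decrease,
so it is at most \<open>N + m\<close> times the limit, and \<open>m\<close> is negligible against \<open>N\<close>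
(\<open>near_le_padded\<close>). For \<open>x = 0\<close> and \<open>x = 1\<close> every mutual information involved is
already at most \<open>\<delta> N ln d\<close> (\<open>near_le_boundary\<close>).

It remains to identify \<open>kappa c\<close>, which is defined through the representing measure, so that
existence and uniqueness of that measure are needed. Testing the functional on systems
consisting of identical fair bits on a set \<open>K\<close> and constants elsewhere yields the sums of \<open>c I S\<close>
over all \<open>S\<close> containing \<open>K\<close> (\<open>mi_functional_coin\<close>); exchangeability and weak additivity
show that such a sum depends on \<open>card K\<close> only (\<open>up_sum_eq_moment\<close>). These numbers are
the moments of the measure sought: if \<open>S\<close> is a random subset of \<open>{1..n}\<close> with probabilities
\<open>c {1..n} S\<close>, they determine the factorial moments of \<open>card S\<close>, and a weak limit of the laws of
\<open>card S / n\<close> is the measure (\<open>moment_measure_exists\<close>). Moments on the unit interval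
determine a measure through its characteristic function (\<open>moments_determine\<close>).\<close>

section \<open>Superadditive sequences\<close>

text \<open>Fekete's lemma. Besides convergence the proof needs that the limit dominates every
average; it is the supremum of the averages.\<close>

lemma superadditive_limit:
  fixes u :: "nat \<Rightarrow> real"
  assumes super: "\<And>m n. u m + u n \<le> u (m + n)"
    and nonneg: "\<And>n. 0 \<le> u n"
    and bound: "\<And>n. u n \<le> B * real n"
  shows "\<exists>L. (\<lambda>n. u n / real n) \<longlonglongrightarrow> L \<and> (\<forall>n. u n \<le> L * real n)"
proof -
  define L where "L = (SUP n\<in>{1..}. u n / real n)"
  have bdd: "bdd_above ((\<lambda>n. u n / real n) ` {1..})"
    using bound by (intro bdd_aboveI2[where M=B]) (auto simp: divide_simps)
  have le: "u n / real n \<le> L" if "n \<ge> 1" for n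
    unfolding L_def using that by (intro cSUP_upper bdd) auto
  have mult: "real q * u m \<le> u (q * m)" for q m
  proof (induction q)
    case 0 show ?case using nonneg by simp
  next
    case (Suc q) then show ?case using super[of m "q * m"] by (simp add: algebra_simps)
  qed
  \<comment> \<open>Cut \<open>n\<close> into \<open>n div m\<close> blocks of length \<open>m\<close>; they cover all but at most \<open>m\<close> of the \<open>n\<close> places.\<close>
  have lower: "(1 - real m / real n) * (u m / real m) \<le> u n / real n" if "m \<ge> 1" "n \<ge> 1" for m n
  proof -
    have "real n \<le> real (n div m * m) + real m"
      using mod_less_divisor[of m n] that unfolding of_nat_add[symmetric] of_nat_le_iff
      by (metis div_mult_mod_eq less_imp_le nat_add_left_cancel_le not_less_eq_eq One_nat_def Suc_le_eq)
    then have "(real n - real m) / real m \<le> real (n div m)"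
      using that by (simp add: field_simps)
    then have "(real n - real m) / real m * u m \<le> real (n div m) * u m"
      by (rule mult_right_mono) (rule nonneg)
    also have "\<dots> \<le> u (n div m * m)" by (rule mult)
    also have "\<dots> \<le> u n"
      using super[of "n div m * m" "n mod m"] nonneg[of "n mod m"] by simp
    finally have "(real n - real m) / real m * u m / real n \<le> u n / real n"
      by (rule divide_right_mono) simp
    also have "(real n - real m) / real m * u m / real n = (1 - real m / real n) * (u m / real m)"
      using that by (simp add: field_simps)
    finally show ?thesis .
  qed
  have "(\<lambda>n. u n / real n) \<longlonglongrightarrow> L"
  proof (rule order_tendstoI)
    fix a assume "a < L"
    then obtain m where m: "m \<ge> 1" "a < u m / real m"
      unfolding L_def using less_cSUP_iff[OF _ bdd] by (metis atLeast_iff empty_iff order_refl)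
    have "(\<lambda>n. (1 - real m / real n) * (u m / real m)) \<longlonglongrightarrow> (1 - 0) * (u m / real m)"
      by (intro tendsto_intros lim_const_over_n)
    then have "eventually (\<lambda>n. a < (1 - real m / real n) * (u m / real m)) sequentially"
      using m by (auto elim: order_tendstoD)
    then show "eventually (\<lambda>n. a < u n / real n) sequentially"
      using eventually_ge_at_top[of 1]
    proof eventually_elim
      case (elim n) then show ?case using lower[OF m(1), of n] by linarith
    qed
  next
    fix a assume "L < a"
    then show "eventually (\<lambda>n. u n / real n < a) sequentially"
      using le by (intro eventually_sequentiallyI[of 1]) (metis le_less_trans)
  qed
  moreover have "u n \<le> L * real n" for n
    using le[of n] bound[of 0] nonneg[of 0] by (cases "n = 0") (auto simp: field_simps)
  ultimately show ?thesis by blast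
qed

section \<open>Entropy and mutual information of finite systems\<close>

lemma entropy_nonneg:
  assumes "prob_space M" shows "0 \<le> shannon_entropy M X"
proof -
  interpret prob_space M by fact
  have "prob A * ln (prob A) \<le> 0" for A
    by (cases "prob A = 0") (auto intro!: mult_nonneg_nonpos simp: zero_less_measure_iff)
  then show ?thesis unfolding shannon_entropy_def
    by (simp add: sum_nonpos)
qed

text \<open>Data processing: a function of \<open>X\<close> carries no more information than \<open>X\<close>.\<close>

lemma entropy_comp_le:
  assumes M: "prob_space M" and X: "simple_function M X"
  shows "shannon_entropy M (\<lambda>\<omega>. f (X \<omega>)) \<le> shannon_entropy M X"
proof -
  interpret prob_space M by fact
  interpret information_space M "exp 1" by unfold_locales simp
  show ?thesis
    using entropy_data_processing[OF X, of f] simple_function_compose[OF X, of f]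
    by (simp add: shannon_entropy_eq_entropy[OF M] X comp_def)
qed

lemma entropy_le_ln_card:
  assumes M: "prob_space M" and X: "simple_function M X"
    and A: "X ` space M \<subseteq> A" "finite A"
  shows "shannon_entropy M X \<le> ln (real (card A))"
proof -
  interpret prob_space M by fact
  interpret information_space M "exp 1" by unfold_locales simp
  have "X ` space M \<noteq> {}" using not_empty by simp
  then have "0 < card (X ` space M)" "card (X ` space M) \<le> card A"
    using A by (auto simp: card_gt_0_iff card_mono intro: finite_subset)
  moreover have "shannon_entropy M X \<le> ln (real (card (X ` space M)))"
    using entropy_le_card[OF simple_distributedI[OF X measure_nonneg refl]]
    by (simp add: shannon_entropy_eq_entropy[OF M X] log_def)
  ultimately show ?thesis by (smt (verit) ln_le_cancel_iff of_nat_0_less_iff of_nat_mono)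
qed

lemma mutual_info_nonneg:
  assumes M: "prob_space M" and X: "simple_function M X" and Y: "simple_function M Y"
  shows "0 \<le> mutual_info M X Y"
proof -
  interpret prob_space M by fact
  interpret information_space M "exp 1" by unfold_locales simp
  show ?thesis
    unfolding mutual_info_eq_mutual_information[OF assms]
    using mutual_information_nonneg_simple[OF X Y] .
qed

text \<open>The joint entropy dominates each marginal entropy.\<close>

lemma mutual_info_le:
  assumes M: "prob_space M" and X: "simple_function M X" and Y: "simple_function M Y"
  shows "mutual_info M X Y \<le> shannon_entropy M X" "mutual_info M X Y \<le> shannon_entropy M Y"
  using entropy_comp_le[OF M simple_function_Pair[OF X Y], of fst]
    entropy_comp_le[OF M simple_function_Pair[OF X Y], of snd]
  by (auto simp: mutual_info_def)

lemma simple_function_count_space: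
  assumes "T \<in> measurable M (count_space A)" "finite A"
  shows "simple_function M T"
proof -
  have "T ` space M \<subseteq> A" using measurable_space[OF assms(1)] by auto
  then show ?thesis
    using assms by (auto simp: simple_function_def intro: finite_subset measurable_sets)
qed

lemma finite_configurations: "finite I \<Longrightarrow> finite (I \<rightarrow>\<^sub>E {..<d::nat})"
  by (intro finite_PiE) auto

lemma system_subset: "system d I M X \<Longrightarrow> S \<subseteq> I \<Longrightarrow> system d S M X"
  by (auto simp: system_def)

lemma simple_function_subsystem:
  assumes "finite I" "system d I M X" "S \<subseteq> I"
  shows "simple_function M (subsystem X S)"
  using subsystem_measurable[of S d M X] assms
  by (auto simp: configurations_def intro!: simple_function_count_space finite_configurations
      intro: finite_subset system_subset)

lemma system_entropy_le:
  assumes "finite S" "system d S M X" "d \<ge> 1"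
  shows "system_entropy S M X \<le> real (card S) * ln (real d)"
proof -
  have M: "prob_space M" using assms by (auto simp: system_def)
  have "subsystem X S ` space M \<subseteq> S \<rightarrow>\<^sub>E {..<d}"
    using measurable_space[OF subsystem_measurable[OF assms(1,2)]] by (auto simp: configurations_def)
  then have "system_entropy S M X \<le> ln (real (card (S \<rightarrow>\<^sub>E {..<d})))"
    unfolding system_entropy_def using assms
    by (intro entropy_le_ln_card M simple_function_subsystem[OF assms(1,2)] finite_configurations) auto
  also have "\<dots> = real (card S) * ln (real d)"
    using assms by (simp add: card_PiE ln_realpow)
  finally show ?thesis .
qed

text \<open>Splitting a configuration into complementary parts loses no information. With this, all
mutual informations in an intricacy are expressed through entropies of subsystems.\<close>

lemma entropy_subsystem_pair:
  assumes "S \<subseteq> I"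
  shows "shannon_entropy M (\<lambda>\<omega>. (subsystem X S \<omega>, subsystem X (I - S) \<omega>)) = system_entropy I M X"
proof -
  let ?f = "\<lambda>x. (restrict x S, restrict x (I - S))"
  have "inj_on ?f (subsystem X I ` space M)"
  proof (rule inj_onI)
    fix x y assume xy: "x \<in> subsystem X I ` space M" "y \<in> subsystem X I ` space M" "?f x = ?f y"
    have "x i = y i" for i
    proof (cases "i \<in> S")
      case True then show ?thesis using xy(3) by (metis Pair_inject restrict_apply)
    next
      case False
      show ?thesis
      proof (cases "i \<in> I")
        case True then show ?thesis using xy(3) False by (metis DiffI Pair_inject restrict_apply)
      next
        case False then show ?thesis using xy(1,2) by (auto simp: subsystem_def)
      qed
    qed
    then show "x = y" by auto
  qed
  from shannon_entropy_inj[OF this] show ?thesis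
    using assms unfolding system_entropy_def
    by (simp add: subsystem_def Int_absorb1 Int_absorb2)
qed

lemma mutual_info_split:
  assumes "S \<subseteq> I"
  shows "mutual_info M (subsystem X S) (subsystem X (I - S)) =
    system_entropy S M X + system_entropy (I - S) M X - system_entropy I M X"
  by (simp add: mutual_info_def entropy_subsystem_pair[OF assms] system_entropy_def)

text \<open>The bound by half of \<open>card I * ln d\<close> comes from the smaller of the two subsystems; the last
bound comes from the maximal entropies of both. The last two bounds make the intricacy small when
the entropy of the system is close to its minimal or maximal value.\<close>

lemma mutual_info_split_bounds:
  assumes I: "finite I" and X: "system d I M X" and S: "S \<subseteq> I" and d: "d \<ge> 1"
  defines "m \<equiv> mutual_info M (subsystem X S) (subsystem X (I - S))"
  shows "0 \<le> m" "m \<le> real (card I) / 2 * ln (real d)" "m \<le> system_entropy I M X"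
    "m \<le> real (card I) * ln (real d) - system_entropy I M X"
proof -
  have M: "prob_space M" using X by (auto simp: system_def)
  have fin: "finite S" "finite (I - S)" using I S by (auto intro: finite_subset)
  have s: "simple_function M (subsystem X S)" "simple_function M (subsystem X (I - S))"
    using simple_function_subsystem[OF I X] S by auto
  have c: "real (card S) + real (card (I - S)) = real (card I)"
    using card_Diff_subset[OF fin(1) S] card_mono[OF I S] by simp
  have e: "system_entropy S M X \<le> real (card S) * ln (real d)"
    "system_entropy (I - S) M X \<le> real (card (I - S)) * ln (real d)"
    using S by (auto intro!: system_entropy_le fin d system_subset[OF X])
  note l = mutual_info_le[OF M s]
  note p = mutual_info_split[OF S, of M X]
  show "0 \<le> m" unfolding m_def by (rule mutual_info_nonneg[OF M s])
  have "2 * m \<le> (real (card S) + real (card (I - S))) * ln (real d)"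
    using l e by (simp add: m_def system_entropy_def algebra_simps)
  then show "m \<le> real (card I) / 2 * ln (real d)" unfolding c by simp
  have "m \<le> (real (card S) + real (card (I - S))) * ln (real d) - system_entropy I M X"
    using p e by (simp add: m_def algebra_simps)
  then show "m \<le> real (card I) * ln (real d) - system_entropy I M X" unfolding c .
  have "system_entropy S M X \<le> system_entropy I M X"
    using entropy_comp_le[OF M simple_function_subsystem[OF I X subset_refl], of "\<lambda>x. restrict x S"] S
    by (simp add: system_entropy_def subsystem_def Int_absorb1 Int_absorb2)
  then show "m \<le> system_entropy I M X" using l by (simp add: m_def system_entropy_def)
qed

text \<open>The coefficients are weights of total mass one, so a bound that holds for every splitting
passes to the average.\<close>

lemma mi_functional_bounds:
  assumes c: "coefficient_system c" and I: "finite_index_set I"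
    and X: "system d I M X" and d: "d \<ge> 1"
  shows "0 \<le> mi_functional c I M X"
    "mi_functional c I M X \<le> real (card I) / 2 * ln (real d)"
    "mi_functional c I M X \<le> system_entropy I M X"
    "mi_functional c I M X \<le> real (card I) * ln (real d) - system_entropy I M X"
proof -
  have fin: "finite I" using I by (simp add: finite_index_set_def)
  have pos: "c I S \<ge> 0" if "S \<in> Pow I" for S
    using c I that by (auto simp: coefficient_system_def)
  have one: "(\<Sum>S\<in>Pow I. c I S) = 1"
    using c I by (auto simp: coefficient_system_def)
  note b = mutual_info_split_bounds[OF fin X _ d]
  have avg: "mi_functional c I M X \<le> B"
    if "\<And>S. S \<subseteq> I \<Longrightarrow> mutual_info M (subsystem X S) (subsystem X (I - S)) \<le> B" for B
  proof -
    have "mi_functional c I M X \<le> (\<Sum>S\<in>Pow I. c I S * B)"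
      unfolding mi_functional_def using that pos by (intro sum_mono mult_left_mono) auto
    then show ?thesis by (simp add: sum_distrib_right[symmetric] one)
  qed
  show "0 \<le> mi_functional c I M X"
    unfolding mi_functional_def using b(1) pos by (intro sum_nonneg mult_nonneg_nonneg) auto
  show "mi_functional c I M X \<le> real (card I) / 2 * ln (real d)" using b(2) by (rule avg)
  show "mi_functional c I M X \<le> system_entropy I M X" using b(3) by (rule avg)
  show "mi_functional c I M X \<le> real (card I) * ln (real d) - system_entropy I M X"
    using b(4) by (rule avg)
qed

section \<open>Independent systems and relabelling\<close>

lemma distr_pair_snd:
  assumes "prob_space M" "prob_space N"
  shows "distr (M \<Otimes>\<^sub>M N) N snd = N"
proof (rule measure_eqI)
  interpret M: prob_space M by fact
  interpret N: prob_space N by fact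
  fix A assume "A \<in> sets (distr (M \<Otimes>\<^sub>M N) N snd)"
  then have A: "A \<in> sets N" by simp
  have "emeasure (distr (M \<Otimes>\<^sub>M N) N snd) A = emeasure (M \<Otimes>\<^sub>M N) (snd -` A \<inter> space (M \<Otimes>\<^sub>M N))"
    using A by (simp add: emeasure_distr)
  also have "snd -` A \<inter> space (M \<Otimes>\<^sub>M N) = space M \<times> A"
    using sets.sets_into_space[OF A] by (auto simp: space_pair_measure)
  finally show "emeasure (distr (M \<Otimes>\<^sub>M N) N snd) A = emeasure N A"
    using A by (simp add: N.emeasure_pair_measure_Times M.emeasure_space_1)
qed simp

text \<open>Under a product measure the joint law of the two components is the product of their laws, and
mutual information is the divergence between these two measures.\<close>

lemma mutual_info_product:
  assumes M: "prob_space M" and N: "prob_space N"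
    and f: "simple_function M f" and g: "simple_function N g"
  shows "mutual_info (M \<Otimes>\<^sub>M N) (\<lambda>\<omega>. f (fst \<omega>)) (\<lambda>\<omega>. g (snd \<omega>)) = 0"
proof -
  interpret M: prob_space M by fact
  interpret N: prob_space N by fact
  let ?P = "M \<Otimes>\<^sub>M N"
  have P: "prob_space ?P" using M N by (rule prob_space_pair)
  interpret P: prob_space ?P by fact
  interpret P: information_space ?P "exp 1" by unfold_locales simp
  let ?f = "\<lambda>\<omega>. f (fst \<omega>)" and ?g = "\<lambda>\<omega>. g (snd \<omega>)"
  have ne: "space M \<noteq> {}" "space N \<noteq> {}" using M.not_empty N.not_empty by auto
  have im: "?f ` space ?P = f ` space M" "?g ` space ?P = g ` space N"
    using ne by (auto simp: space_pair_measure image_iff)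
  let ?S = "count_space (f ` space M)" and ?T = "count_space (g ` space N)"
  have fm: "f \<in> measurable M ?S" and gm: "g \<in> measurable N ?T"
    using f g by (auto simp: measurable_count_space_eq2 simple_function_def)
  have fP: "?f \<in> measurable ?P ?S" and gP: "?g \<in> measurable ?P ?T"
    using fm gm by measurable
  have sf: "simple_function ?P ?f" "simple_function ?P ?g"
    using simple_function_count_space[OF fP] simple_function_count_space[OF gP] f g
    by (auto simp: simple_function_def)
  have "sigma_finite_measure (distr N ?T g)"
    using N.prob_space_distr[OF gm] by (simp add: prob_space_imp_sigma_finite)
  from pair_measure_distr[OF fm gm this]
  have "distr ?P (?S \<Otimes>\<^sub>M ?T) (\<lambda>\<omega>. (?f \<omega>, ?g \<omega>)) = distr M ?S f \<Otimes>\<^sub>M distr N ?T g"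
    by (simp add: case_prod_unfold)
  also have "distr M ?S f = distr ?P ?S ?f"
    using distr_distr[OF fm measurable_fst[of M N]] by (simp add: N.distr_pair_fst comp_def)
  also have "distr N ?T g = distr ?P ?T ?g"
    using distr_distr[OF gm measurable_snd[of M N]] by (simp add: distr_pair_snd[OF M N] comp_def)
  finally have eq: "distr ?P (?S \<Otimes>\<^sub>M ?T) (\<lambda>\<omega>. (?f \<omega>, ?g \<omega>)) = distr ?P ?S ?f \<Otimes>\<^sub>M distr ?P ?T ?g" .
  have "sigma_finite_measure (distr ?P (?S \<Otimes>\<^sub>M ?T) (\<lambda>\<omega>. (?f \<omega>, ?g \<omega>)))"
    by (intro prob_space_imp_sigma_finite P.prob_space_distr measurable_Pair fP gP)
  then show ?thesis
    unfolding mutual_info_eq_mutual_information[OF P sf] im P.mutual_information_def eq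
    by (intro sigma_finite_measure.KL_same_eq_0)
qed

text \<open>The system on the disjoint union of two index sets whose two parts live on separate factors of
a product space and are therefore independent.\<close>

definition join_systems ::
    "nat set \<Rightarrow> (nat \<Rightarrow> 'a \<Rightarrow> nat) \<Rightarrow> (nat \<Rightarrow> 'b \<Rightarrow> nat) \<Rightarrow> nat \<Rightarrow> 'a \<times> 'b \<Rightarrow> nat" where
  "join_systems I X Y i \<omega> = (if i \<in> I then X i (fst \<omega>) else Y i (snd \<omega>))"

lemma system_coords:
  assumes "\<mu> \<in> laws d I" shows "system d I \<mu> coords"
proof -
  have "sets \<mu> = sets (configurations d I)" using assms by (simp add: laws_def)
  moreover have "coords i \<in> measurable (configurations d I) (count_space {..<d})" if "i \<in> I" for i
    using that by (auto simp: configurations_def coords_def)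
  ultimately show ?thesis
    using assms by (auto simp: system_def laws_def cong: measurable_cong_sets)
qed

text \<open>Intricacy and entropy depend on the law alone. This moves systems between sample spaces of
different types, while exchangeability and weak additivity are hypotheses about one fixed type.\<close>

lemma same_law:
  assumes I: "finite I" and X: "system d I M X" and Y: "system d I N Y"
    and eq: "distr M (configurations d I) (subsystem X I) = distr N (configurations d I) (subsystem Y I)"
  shows "mi_functional c I M X = mi_functional c I N Y"
    "system_entropy I M X = system_entropy I N Y"
  using mi_functional_eq_law[OF I X] mi_functional_eq_law[OF I Y] unfolding eq by auto

text \<open>Weak additivity can be invoked only for two systems on a common space of configurations.
Therefore the joint system is replaced by its law \<open>Q\<close>, where the two coordinate subsystems
are shown to be independent, and the result is transported back.\<close>

lemma join_systems_additive:
  assumes c: "weakly_additive c" and d: "d \<ge> 2"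
    and I: "finite_index_set I" and J: "finite_index_set J" and IJ: "I \<inter> J = {}"
    and X: "system d I M X" and Y: "system d J N Y"
  defines "P \<equiv> M \<Otimes>\<^sub>M N" and "Z \<equiv> join_systems I X Y"
  shows "system d (I \<union> J) P Z"
    "mi_functional c (I \<union> J) P Z = mi_functional c I M X + mi_functional c J N Y"
    "system_entropy (I \<union> J) P Z = system_entropy I M X + system_entropy J N Y"
proof -
  have fin: "finite I" "finite J" "finite (I \<union> J)" using I J by (auto simp: finite_index_set_def)
  have M: "prob_space M" and N: "prob_space N" using X Y by (auto simp: system_def)
  interpret M: prob_space M by fact
  interpret N: prob_space N by fact
  have P: "prob_space P" unfolding P_def using M N by (rule prob_space_pair)
  interpret P: prob_space P by fact
  have [measurable]: "X i \<in> measurable M (count_space {..<d})" if "i \<in> I" for i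
    using X that by (auto simp: system_def)
  have [measurable]: "Y i \<in> measurable N (count_space {..<d})" if "i \<in> J" for i
    using Y that by (auto simp: system_def)
  have "Z i \<in> measurable P (count_space {..<d})" if "i \<in> I \<union> J" for i
  proof (cases "i \<in> I")
    case True then show ?thesis unfolding Z_def P_def join_systems_def by simp
  next
    case False
    then show ?thesis using that unfolding Z_def P_def join_systems_def by simp
  qed
  then show Z: "system d (I \<union> J) P Z" using P by (auto simp: system_def)
  have ZI: "subsystem Z I \<omega> = subsystem X I (fst \<omega>)" and ZJ: "subsystem Z J \<omega> = subsystem Y J (snd \<omega>)" for \<omega>
    using IJ by (auto simp: subsystem_def Z_def join_systems_def restrict_def fun_eq_iff)

  define T where "T = subsystem Z (I \<union> J)"
  define Q where "Q = distr P (configurations d (I \<union> J)) T"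
  have Tm: "T \<in> measurable P (configurations d (I \<union> J))"
    unfolding T_def by (rule subsystem_measurable[OF fin(3) Z])
  have Q: "Q \<in> laws d (I \<union> J)" unfolding Q_def T_def by (rule law_in_laws[OF fin(3) Z])
  interpret Q: prob_space Q using Q by (simp add: laws_def)
  have QIJ: "system d (I \<union> J) Q coords" by (rule system_coords[OF Q])
  then have QI: "system d I Q coords" and QJ: "system d J Q coords" by (auto intro: system_subset)
  note mX = subsystem_measurable[OF fin(1) X] and mY = subsystem_measurable[OF fin(2) Y]
  note mI = subsystem_measurable[OF fin(1) QI] and mJ = subsystem_measurable[OF fin(2) QJ]
  have TI: "subsystem coords I (T \<omega>) = subsystem X I (fst \<omega>)"
    and TJ: "subsystem coords J (T \<omega>) = subsystem Y J (snd \<omega>)" for \<omega>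
    by (auto simp: T_def subsystem_coords_subsystem ZI ZJ)
  have push: "distr Q K f = distr P K (\<lambda>\<omega>. f (T \<omega>))" if "f \<in> measurable Q K" for K and f :: "_ \<Rightarrow> 'c"
    using distr_distr[OF _ Tm, of f K] that unfolding Q_def by (simp add: comp_def)
  have lawI: "distr Q (configurations d I) (subsystem coords I) = distr M (configurations d I) (subsystem X I)"
    using distr_distr[OF mX measurable_fst[of M N]]
    by (simp add: push[OF mI] TI N.distr_pair_fst comp_def P_def)
  have lawJ: "distr Q (configurations d J) (subsystem coords J) = distr N (configurations d J) (subsystem Y J)"
    using distr_distr[OF mY measurable_snd[of M N]]
    by (simp add: push[OF mJ] TJ distr_pair_snd[OF M N] comp_def P_def)
  have "sigma_finite_measure (distr N (configurations d J) (subsystem Y J))"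
    by (intro prob_space_imp_sigma_finite N.prob_space_distr mY)
  from pair_measure_distr[OF mX mY this]
  have "distr Q (configurations d I) (subsystem coords I) \<Otimes>\<^sub>M distr Q (configurations d J) (subsystem coords J)
      = distr Q (configurations d I \<Otimes>\<^sub>M configurations d J) (\<lambda>\<omega>. (subsystem coords I \<omega>, subsystem coords J \<omega>))"
    by (simp add: push[OF measurable_Pair[OF mI mJ]] TI TJ lawI lawJ case_prod_unfold P_def)
  then have indep: "Q.indep_var (configurations d I) (subsystem coords I) (configurations d J) (subsystem coords J)"
    using mI mJ by (simp add: Q.indep_var_distribution_eq)
  have "mi_functional c (I \<union> J) Q (\<lambda>i. if i \<in> I then coords i else coords i) =
      mi_functional c I Q coords + mi_functional c J Q coords"
    using c[unfolded weakly_additive_def, rule_format, OF d I J IJ _ _ indep] QI QJ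
    by (simp add: systems_def)
  moreover have "mi_functional c I Q coords = mi_functional c I M X"
    by (rule same_law[OF fin(1) QI X lawI])
  moreover have "mi_functional c J Q coords = mi_functional c J N Y"
    by (rule same_law[OF fin(2) QJ Y lawJ])
  moreover have "mi_functional c (I \<union> J) Q coords = mi_functional c (I \<union> J) P Z"
    using mi_functional_eq_law(1)[OF fin(3) Z, of c]
    by (simp add: mi_functional_law_def Q_def T_def)
  ultimately show "mi_functional c (I \<union> J) P Z = mi_functional c I M X + mi_functional c J N Y"
    by simp

  have sX: "simple_function M (subsystem X I)" and sY: "simple_function N (subsystem Y J)"
    using X Y fin by (auto intro: simple_function_subsystem)
  have "mutual_info P (subsystem Z I) (subsystem Z J) = 0"
    using mutual_info_product[OF M N sX sY] by (simp add: P_def ZI[abs_def] ZJ[abs_def])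
  moreover have "(I \<union> J) - I = J" using IJ by auto
  ultimately have "system_entropy (I \<union> J) P Z = system_entropy I P Z + system_entropy J P Z"
    using mutual_info_split[of I "I \<union> J" P Z] by simp
  also have "system_entropy I P Z = system_entropy I M X"
    using distr_distr[OF mX measurable_fst[of M N]]
    by (intro same_law[OF fin(1) system_subset[OF Z] X])
      (auto simp: ZI[abs_def] P_def N.distr_pair_fst comp_def)
  also have "system_entropy J P Z = system_entropy J N Y"
    using distr_distr[OF mY measurable_snd[of M N]]
    by (intro same_law[OF fin(2) system_subset[OF Z] Y])
      (auto simp: ZJ[abs_def] P_def distr_pair_snd[OF M N] comp_def)
  finally show "system_entropy (I \<union> J) P Z = system_entropy I M X + system_entropy J N Y" .
qed

text \<open>Exchangeability, for an arbitrary sample space: pass to the law, relabel there, and return.\<close>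

lemma relabel_system:
  assumes c: "exchangeable c" and d: "d \<ge> 2"
    and I: "finite_index_set I" and J: "finite_index_set J" and \<phi>: "bij_betw \<phi> I J"
    and X: "system d I M X"
  defines "Y \<equiv> \<lambda>j. X (inv_into I \<phi> j)"
  shows "system d J M Y" "mi_functional c I M X = mi_functional c J M Y"
    "system_entropy I M X = system_entropy J M Y"
proof -
  have fin: "finite I" "finite J" using I J by (auto simp: finite_index_set_def)
  have inv: "bij_betw (inv_into I \<phi>) J I" using \<phi> by (rule bij_betw_inv_into)
  have sub: "system d J M (\<lambda>j. X' (inv_into I \<phi> j))" if "system d I M X'" for M :: "'c measure" and X'
    using that bij_betwE[OF inv] by (auto simp: system_def)
  show Y: "system d J M Y" unfolding Y_def by (rule sub[OF X])
  define \<mu> where "\<mu> = distr M (configurations d I) (subsystem X I)"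
  have \<mu>: "\<mu> \<in> laws d I" unfolding \<mu>_def by (rule law_in_laws[OF fin(1) X])
  let ?Y' = "\<lambda>j. coords (inv_into I \<phi> j)"
  have Y': "system d J \<mu> ?Y'" by (rule sub[OF system_coords[OF \<mu>]])
  have "mi_functional c I M X = mi_functional c I \<mu> coords"
    using mi_functional_eq_law(1)[OF fin(1) X, of c] by (simp add: mi_functional_law_def \<mu>_def)
  also have "\<dots> = mi_functional c J \<mu> ?Y'"
    using c d I J \<phi> system_coords[OF \<mu>] unfolding exchangeable_def by (auto simp: systems_def)
  also have "\<dots> = mi_functional c J M Y"
  proof (rule same_law[OF fin(2) Y' Y])
    have "subsystem ?Y' J (subsystem X I \<omega>) = subsystem Y J \<omega>" for \<omega>
      using bij_betwE[OF inv] by (auto simp: subsystem_def coords_def Y_def)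
    then show "distr \<mu> (configurations d J) (subsystem ?Y' J) = distr M (configurations d J) (subsystem Y J)"
      using distr_distr[OF _ subsystem_measurable[OF fin(1) X], of "subsystem ?Y' J" "configurations d J"]
        subsystem_measurable[OF fin(2) Y']
      by (simp add: \<mu>_def comp_def)
  qed
  finally show "mi_functional c I M X = mi_functional c J M Y" .
  let ?f = "\<lambda>x. \<lambda>j\<in>J. x (inv_into I \<phi> j)"
  have "inj_on ?f (subsystem X I ` space M)"
  proof (rule inj_onI)
    fix x y assume xy: "x \<in> subsystem X I ` space M" "y \<in> subsystem X I ` space M" "?f x = ?f y"
    have "x i = y i" for i
    proof (cases "i \<in> I")
      case True
      then have "\<phi> i \<in> J" "inv_into I \<phi> (\<phi> i) = i"
        using \<phi> by (auto simp: bij_betw_def)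
      then show ?thesis using xy(3) by (metis (no_types, lifting) restrict_apply')
    next
      case False then show ?thesis using xy(1,2) by (auto simp: subsystem_def)
    qed
    then show "x = y" by auto
  qed
  from shannon_entropy_inj[OF this]
  have "shannon_entropy M (\<lambda>\<omega>. ?f (subsystem X I \<omega>)) = system_entropy I M X"
    by (simp add: system_entropy_def)
  moreover have "?f (subsystem X I \<omega>) = subsystem Y J \<omega>" for \<omega>
    using bij_betwE[OF inv] by (auto simp: subsystem_def Y_def)
  ultimately show "system_entropy I M X = system_entropy J M Y" by (simp add: system_entropy_def)
qed

lemma finite_index_set_atLeastAtMost [simp]: "finite_index_set {Suc m..n}"
  by (auto simp: finite_index_set_def)

text \<open>The source of superadditivity: the second system is shifted to the indices after \<open>m\<close> and
joined independently to the first.\<close>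

lemma concatenate_laws:
  assumes c: "intricacy c" and d: "d \<ge> 2"
    and X: "system d {1..m} M X" and Y: "system d {1..n} N Y"
  shows "\<exists>\<mu>\<in>laws d {1..m + n}.
    mi_functional_law c {1..m + n} \<mu> = mi_functional c {1..m} M X + mi_functional c {1..n} N Y \<and>
    entropy_law {1..m + n} \<mu> = system_entropy {1..m} M X + system_entropy {1..n} N Y"
proof -
  let ?J = "{m + 1..m + n}"
  have \<phi>: "bij_betw (\<lambda>i. i + m) {1..n} ?J"
    by (rule bij_betw_byWitness[where f' = "\<lambda>i. i - m"]) auto
  define Y' where "Y' = (\<lambda>j. Y (inv_into {1..n} (\<lambda>i. i + m) j))"
  have ex: "exchangeable c" and wa: "weakly_additive c" using c by (auto simp: intricacy_def)
  have J: "finite_index_set ?J" "finite_index_set {1..m}" "finite_index_set {1..n}" by simp_all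
  note Y' = relabel_system[OF ex d J(3,1) \<phi> Y, folded Y'_def]
  have un: "{1..m} \<union> ?J = {1..m + n}" by auto
  have dj: "{1..m} \<inter> ?J = {}" by auto
  note Z = join_systems_additive[OF wa d J(2,1) dj X Y'(1), unfolded un]
  have fin: "finite {1..m + n}" by simp
  show ?thesis
    using law_in_laws[OF fin Z(1)] mi_functional_eq_law[OF fin Z(1)] Z(2,3) Y'(2,3)
    by (metis (no_types, lifting))
qed

section \<open>Suprema over families of laws closed under concatenation\<close>

lemma law_bounds:
  assumes c: "coefficient_system c" and d: "d \<ge> 2" and \<mu>: "\<mu> \<in> laws d {1..N}"
  shows "0 \<le> mi_functional_law c {1..N} \<mu>"
    "mi_functional_law c {1..N} \<mu> \<le> ln (real d) / 2 * real N"
    "0 \<le> entropy_law {1..N} \<mu>" "entropy_law {1..N} \<mu> \<le> real N * ln (real d)"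
  using mi_functional_bounds[OF c _ system_coords[OF \<mu>]] d \<mu>
    system_entropy_le[OF _ system_coords[OF \<mu>]] entropy_nonneg[of \<mu>]
  by (auto simp: mi_functional_law_def entropy_law_def laws_def system_entropy_def mult.commute)

lemma bdd_above_mi_functional_law:
  assumes "coefficient_system c" "d \<ge> 2" "A \<subseteq> laws d {1..N}"
  shows "bdd_above (mi_functional_law c {1..N} ` A)"
  using law_bounds(2)[OF assms(1,2)] assms(3) by (intro bdd_aboveI2) blast

text \<open>Fekete's lemma for suprema of the intricacy. It is used with all laws and with the laws whose
entropy is a fixed fraction of the maximum; both families are closed under independent
concatenation.\<close>

lemma sup_laws_limit:
  assumes c: "intricacy c" and d: "d \<ge> 2"
    and A: "\<And>n. A n \<subseteq> laws d {1..n}" "\<And>n. A n \<noteq> {}"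
    and join: "\<And>m n \<mu> \<nu>. \<mu> \<in> A m \<Longrightarrow> \<nu> \<in> A n \<Longrightarrow> \<exists>\<rho>\<in>A (m + n).
      mi_functional_law c {1..m + n} \<rho> = mi_functional_law c {1..m} \<mu> + mi_functional_law c {1..n} \<nu>"
  defines "u \<equiv> \<lambda>n. SUP \<mu>\<in>A n. mi_functional_law c {1..n} \<mu>"
  shows "\<exists>L. (\<lambda>n. u n / real n) \<longlonglongrightarrow> L \<and> (\<forall>n. u n \<le> L * real n)"
proof (rule superadditive_limit)
  have cs: "coefficient_system c" using c by (simp add: intricacy_def)
  have up: "mi_functional_law c {1..n} \<mu> \<le> u n" if "\<mu> \<in> A n" for \<mu> n
    unfolding u_def using that by (intro cSUP_upper bdd_above_mi_functional_law[OF cs d A(1)])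
  have least: "u n \<le> K" if "\<And>\<mu>. \<mu> \<in> A n \<Longrightarrow> mi_functional_law c {1..n} \<mu> \<le> K" for n K
    unfolding u_def using that A(2) by (intro cSUP_least)
  show "u m + u n \<le> u (m + n)" for m n
  proof -
    have "mi_functional_law c {1..m} \<mu> \<le> u (m + n) - u n" if \<mu>: "\<mu> \<in> A m" for \<mu>
    proof -
      have "mi_functional_law c {1..n} \<nu> \<le> u (m + n) - mi_functional_law c {1..m} \<mu>" if "\<nu> \<in> A n" for \<nu>
        using join[OF \<mu> that] up[of _ "m + n"] by fastforce
      from least[OF this] show ?thesis by simp
    qed
    from least[OF this] show ?thesis by simp
  qed
  show "0 \<le> u n" for n
  proof -
    obtain \<mu> where "\<mu> \<in> A n" using A(2) by blast
    then show ?thesis using up[of \<mu> n] law_bounds(1)[OF cs d, of \<mu> n] A(1) by fastforce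
  qed
  show "u n \<le> ln (real d) / 2 * real n" for n
    using A(1) law_bounds(2)[OF cs d] by (intro least) blast
qed

section \<open>Laws with prescribed entropy\<close>

definition pmf_entropy :: "nat \<Rightarrow> nat pmf \<Rightarrow> real" where
  "pmf_entropy d q = - (\<Sum>a<d. pmf q a * ln (pmf q a))"

text \<open>The index set \<open>A\<close> may be larger or smaller than the range of \<open>X\<close>, since values of
probability zero contribute nothing. Finiteness of the range matters because
\<open>shannon_entropy\<close> sums over it.\<close>

lemma shannon_entropy_pmf:
  assumes "finite (range X)" "finite A" "set_pmf (map_pmf X p) \<subseteq> A"
  shows "shannon_entropy (measure_pmf p) X =
    - (\<Sum>a\<in>A. pmf (map_pmf X p) a * ln (pmf (map_pmf X p) a))"
proof -
  have "(\<Sum>a\<in>A. pmf (map_pmf X p) a * ln (pmf (map_pmf X p) a)) =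
      (\<Sum>a\<in>set_pmf (map_pmf X p). pmf (map_pmf X p) a * ln (pmf (map_pmf X p) a))"
    using assms by (intro sum.mono_neutral_right) (auto simp: pmf_eq_0_set_pmf)
  also have "\<dots> = (\<Sum>a\<in>range X. pmf (map_pmf X p) a * ln (pmf (map_pmf X p) a))"
    using assms by (intro sum.mono_neutral_left) (auto simp: pmf_eq_0_set_pmf)
  finally show ?thesis by (simp add: shannon_entropy_def pmf_map)
qed

lemma shannon_entropy_pmf_nat:
  assumes "finite (range X)" "map_pmf X p = q" "set_pmf q \<subseteq> {..<d}"
  shows "shannon_entropy (measure_pmf p) X = pmf_entropy d q"
  using shannon_entropy_pmf[of X "{..<d}" p] assms by (simp add: pmf_entropy_def)

text \<open>At zero the function is squeezed by \<open>\<bar>x ln x\<bar> \<le> 2 sqrt x\<close>, which follows from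
\<open>ln y \<le> y\<close> for \<open>y = 1 / sqrt x\<close>.\<close>

lemma continuous_on_x_ln_x: "continuous_on {0..} (\<lambda>x::real. x * ln x)"
proof -
  have "((\<lambda>x::real. x * ln x) \<longlongrightarrow> 0) (at_right 0)"
  proof (rule tendsto_rabs_zero_cancel, rule tendsto_sandwich[where f = "\<lambda>_. 0" and h = "\<lambda>x. 2 * sqrt x"])
    have "\<bar>x * ln x\<bar> \<le> 2 * sqrt x" if "0 < x" "x < 1" for x :: real
    proof -
      have "ln (1 / sqrt x) \<le> 1 / sqrt x" using that by (intro less_imp_le ln_less_self) auto
      then have "- ln x \<le> 2 / sqrt x" using that by (simp add: ln_div ln_sqrt)
      then have "x * - ln x \<le> x * (2 / sqrt x)" using that by (intro mult_left_mono) auto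
      also have "\<dots> = 2 * (x / sqrt x)" by simp
      also have "x / sqrt x = sqrt x" using that by (simp add: real_div_sqrt)
      finally have "x * - ln x \<le> 2 * sqrt x" .
      moreover have "ln x < 0" using that by simp
      ultimately show ?thesis using that by (simp add: abs_mult)
    qed
    then show "eventually (\<lambda>x. \<bar>x * ln x\<bar> \<le> 2 * sqrt x) (at_right 0)"
      by (auto simp: eventually_at_right_field intro!: exI[of _ 1])
    have "isCont (\<lambda>x. 2 * sqrt x) 0" by (intro continuous_intros)
    then show "((\<lambda>x. 2 * sqrt x) \<longlongrightarrow> 0) (at_right 0)"
      by (simp add: isCont_def filterlim_at_split)
  qed auto
  then have "continuous (at 0 within {0..}) (\<lambda>x::real. x * ln x)"
    by (simp add: continuous_within at_within_Ici_at_right)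
  moreover have "continuous (at x within {0..}) (\<lambda>x::real. x * ln x)" if "x > 0" for x
    using that by (intro continuous_intros) auto
  ultimately show ?thesis
    unfolding continuous_on_eq_continuous_within by (metis atLeast_iff order_le_less)
qed

text \<open>Interpolate linearly between a point mass, of entropy zero, and the uniform distribution, of
entropy \<open>ln d\<close>; the intermediate value theorem does the rest.\<close>

lemma exists_pmf_entropy:
  assumes d: "d \<ge> 1" and y: "0 \<le> y" "y \<le> ln (real d)"
  shows "\<exists>q. set_pmf q \<subseteq> {..<d} \<and> pmf_entropy d q = y"
proof -
  define q where "q t = bernoulli_pmf t \<bind> (\<lambda>b. if b then pmf_of_set {..<d} else return_pmf 0)" for t
  have ne: "{..<d} \<noteq> {}" using d by (auto simp: lessThan_empty_iff)
  have pq: "pmf (q t) a = t * (if a < d then 1 / real d else 0) + (1 - t) * (if a = 0 then 1 else 0)"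
    if "t \<in> {0..1}" for t a
    using that d ne by (simp add: q_def pmf_bind indicator_def)
  define f where "f t = - (\<Sum>a<d. (t / real d + (1 - t) * (if a = 0 then 1 else 0)) *
      ln (t / real d + (1 - t) * (if a = 0 then 1 else 0)))" for t
  have fq: "pmf_entropy d (q t) = f t" if "t \<in> {0..1}" for t
    unfolding pmf_entropy_def f_def using pq[OF that] by simp
  have "f 0 = - (\<Sum>a<d. if a = 0 then 1 * ln 1 else 0 * ln 0)"
    unfolding f_def by (intro arg_cong[where f=uminus] sum.cong) auto
  also have "\<dots> = 0" by (simp add: sum.neutral)
  finally have f0: "f 0 = 0" .
  have f1: "f 1 = ln (real d)" using d by (simp add: f_def ln_div)
  have "continuous_on {0..1} (\<lambda>t. t / real d + (1 - t) * (if a = 0 then 1 else 0))" for a :: nat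
    using d by (intro continuous_intros) auto
  then have "continuous_on {0..1} f"
    unfolding f_def using d
    by (intro continuous_intros continuous_on_compose2[OF continuous_on_x_ln_x]) auto
  with IVT'[of f 0 y 1] y f0 f1 obtain t where t: "t \<in> {0..1}" "f t = y" by auto
  have "set_pmf (q t) \<subseteq> {..<d}"
    using d by (auto simp: q_def set_pmf_of_set[OF ne finite_lessThan] split: if_splits)
  with t fq show ?thesis by blast
qed

lemma system_entropy_singleton:
  "system_entropy {i} M X = shannon_entropy M (X i)"
proof -
  have "inj_on (\<lambda>v. \<lambda>j\<in>{i}. v) (X i ` space M)"
    by (rule inj_onI) (metis restrict_apply' singletonI)
  from shannon_entropy_inj[OF this] show ?thesis
    by (simp add: system_entropy_def subsystem_def restrict_def cong: if_cong)
qed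

lemma system_measure_pmf:
  assumes "\<And>i \<omega>. i \<in> I \<Longrightarrow> X i \<omega> < d"
  shows "system d I (measure_pmf p) X"
  using assms by (auto simp: system_def intro: prob_space_measure_pmf)

lemma finite_range_less: "(\<And>\<omega>. X \<omega> < d) \<Longrightarrow> finite (range (X :: _ \<Rightarrow> nat))"
  by (rule finite_subset[of _ "{..<d}"]) auto

lemma map_pmf_mod:
  assumes "set_pmf q \<subseteq> {..<d::nat}"
  shows "map_pmf (\<lambda>a. a mod d) q = q"
proof -
  have "map_pmf (\<lambda>a. a mod d) q = map_pmf (\<lambda>a. a) q"
    using assms by (intro map_pmf_cong) (auto simp: subset_iff)
  then show ?thesis by simp
qed

text \<open>Concatenate \<open>n\<close> independent coordinates, each of entropy \<open>h / n\<close>.\<close>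

lemma exists_law_entropy:
  assumes c: "intricacy c" and d: "d \<ge> 2" and h: "0 \<le> h" "h \<le> real n * ln (real d)"
  shows "\<exists>\<mu>\<in>laws d {1..n}. entropy_law {1..n} \<mu> = h"
proof (cases "n = 0")
  case True
  have "system d {} (measure_pmf (return_pmf (0::nat))) (\<lambda>i \<omega>. 0)"
    by (rule system_measure_pmf) auto
  from law_in_laws[OF _ this] obtain \<mu> where "\<mu> \<in> laws d {1..n}" using True by auto
  moreover have "coefficient_system c" using c by (simp add: intricacy_def)
  ultimately show ?thesis using law_bounds(3,4)[of c d \<mu> n] d h True by force
next
  case False
  define y where "y = h / real n"
  have y: "0 \<le> y" "y \<le> ln (real d)" using h False by (auto simp: y_def field_simps)
  obtain q where q: "set_pmf q \<subseteq> {..<d}" "pmf_entropy d q = y"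
    using exists_pmf_entropy[of d y] y d by auto
  \<comment> \<open>Reduction modulo \<open>d\<close> changes nothing on the support of \<open>q\<close>, but makes the range finite.\<close>
  define X :: "nat \<Rightarrow> nat \<Rightarrow> nat" where "X i \<omega> = \<omega> mod d" for i \<omega>
  have lt: "X i \<omega> < d" for i \<omega> using d by (simp add: X_def)
  have X: "system d {1..1} (measure_pmf q) X" by (rule system_measure_pmf) (rule lt)
  have hX: "system_entropy {1..1} (measure_pmf q) X = y"
    using shannon_entropy_pmf_nat[OF finite_range_less[of "X 1" d, OF lt], of q q d] q map_pmf_mod[OF q(1)]
    by (simp add: system_entropy_singleton X_def[abs_def])
  have "m \<ge> 1 \<Longrightarrow> \<exists>\<mu>\<in>laws d {1..m}. entropy_law {1..m} \<mu> = real m * y" for m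
  proof (induction m rule: nat_induct_at_least)
    case base
    show ?case using law_in_laws[OF _ X] mi_functional_eq_law(2)[OF _ X] hX by auto
  next
    case (Suc m)
    then obtain \<mu> where \<mu>: "\<mu> \<in> laws d {1..m}" "entropy_law {1..m} \<mu> = real m * y" by auto
    from concatenate_laws[OF c d system_coords[OF \<mu>(1)] X] hX \<mu>(2)
    show ?case by (auto simp: entropy_law_def algebra_simps)
  qed
  from this[of n] show ?thesis using False by (auto simp: y_def)
qed

lemma exists_law_entropy_fraction:
  assumes c: "intricacy c" and d: "d \<ge> 2" and x: "x \<in> {0..1}"
  shows "\<exists>\<mu>\<in>laws d {1..n}. entropy_law {1..n} \<mu> = x * real n * ln (real d)"
proof (rule exists_law_entropy[OF c d])
  show "0 \<le> x * real n * ln (real d)" using x d by simp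
  have "x * (real n * ln (real d)) \<le> 1 * (real n * ln (real d))"
    using x d by (intro mult_right_mono) auto
  then show "x * real n * ln (real d) \<le> real n * ln (real d)" by (simp add: mult.assoc)
qed

section \<open>Existence of the limits\<close>

lemma concatenate_entropy_laws:
  assumes c: "intricacy c" and d: "d \<ge> 2" and \<mu>: "\<mu> \<in> laws d {1..m}" and \<nu>: "\<nu> \<in> laws d {1..n}"
  shows "\<exists>\<rho>\<in>laws d {1..m + n}.
    mi_functional_law c {1..m + n} \<rho> = mi_functional_law c {1..m} \<mu> + mi_functional_law c {1..n} \<nu> \<and>
    entropy_law {1..m + n} \<rho> = entropy_law {1..m} \<mu> + entropy_law {1..n} \<nu>"
  using concatenate_laws[OF c d system_coords[OF \<mu>] system_coords[OF \<nu>]]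
  by (simp add: mi_functional_law_def entropy_law_def)

lemma max_intricacy_limit:
  assumes c: "intricacy c" and d: "d \<ge> 2"
  shows "\<exists>L. (\<lambda>n. max_intricacy c d n / real n) \<longlonglongrightarrow> L \<and> (\<forall>n. max_intricacy c d n \<le> L * real n)"
  unfolding max_intricacy_def
proof (rule sup_laws_limit[OF c d])
  show "laws d {1..n} \<noteq> {}" for n using exists_law_entropy[OF c d, of 0 n] d by auto
qed (use concatenate_entropy_laws[OF c d] in blast)+

lemma max_intricacy_at_limit:
  assumes c: "intricacy c" and d: "d \<ge> 2" and x: "x \<in> {0..1}"
  shows "\<exists>L. (\<lambda>n. max_intricacy_at c d n x / real n) \<longlonglongrightarrow> L \<and>
    (\<forall>n. max_intricacy_at c d n x \<le> L * real n)"
  unfolding max_intricacy_at_def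
proof (rule sup_laws_limit[OF c d])
  fix n
  show "{\<mu> \<in> laws d {1..n}. entropy_law {1..n} \<mu> = x * real n * ln (real d)} \<noteq> {}"
    using exists_law_entropy_fraction[OF c d x] by auto
next
  fix m n \<mu> \<nu>
  assume "\<mu> \<in> {\<mu> \<in> laws d {1..m}. entropy_law {1..m} \<mu> = x * real m * ln (real d)}"
    "\<nu> \<in> {\<mu> \<in> laws d {1..n}. entropy_law {1..n} \<mu> = x * real n * ln (real d)}"
  then show "\<exists>\<rho>\<in>{\<mu> \<in> laws d {1..m + n}. entropy_law {1..m + n} \<mu> = x * real (m + n) * ln (real d)}.
      mi_functional_law c {1..m + n} \<rho> = mi_functional_law c {1..m} \<mu> + mi_functional_law c {1..n} \<nu>"
    using concatenate_entropy_laws[OF c d, of \<mu> m \<nu> n] by (fastforce simp: algebra_simps)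
qed auto

lemma max_intricacy_at_upper:
  assumes c: "intricacy c" and d: "d \<ge> 2"
    and \<mu>: "\<mu> \<in> laws d {1..N}" "entropy_law {1..N} \<mu> = x * real N * ln (real d)"
  shows "mi_functional_law c {1..N} \<mu> \<le> max_intricacy_at c d N x"
  unfolding max_intricacy_at_def using c d \<mu>
  by (intro cSUP_upper bdd_above_mi_functional_law) (auto simp: intricacy_def)

lemma max_intricacy_at_le:
  assumes c: "intricacy c" and d: "d \<ge> 2" and x: "x \<in> {0..1}"
  shows "max_intricacy_at c d N x \<le> max_intricacy c d N"
proof -
  have "{\<mu> \<in> laws d {1..N}. entropy_law {1..N} \<mu> = x * real N * ln (real d)} \<noteq> {}"
    using exists_law_entropy_fraction[OF c d x] by auto
  then show ?thesis
    unfolding max_intricacy_at_def max_intricacy_def using c d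
    by (intro cSUP_subset_mono bdd_above_mi_functional_law) (auto simp: intricacy_def)
qed

section \<open>A pair of coordinates with large mutual information\<close>

lemma mi_functional_two:
  assumes c: "coefficient_system c" and M: "prob_space M"
  shows "mi_functional c {1..2} M X = 2 * c {1..2} {1} *
    (system_entropy {1} M X + system_entropy {2} M X - system_entropy {1..2} M X)"
proof -
  have I: "{1..2} = {1, 2::nat}" by auto
  have D: "{1, 2} - {1} = {2::nat}" "{1, 2} - {2} = {1::nat}" by auto
  have "finite_index_set {1, 2}" by (simp add: finite_index_set_def)
  then have sym: "c {1, 2} {2} = c {1, 2} {1}"
    using c D unfolding coefficient_system_def by (metis insertI1 empty_subsetI insert_subset)
  let ?m = "system_entropy {1} M X + system_entropy {2} M X - system_entropy {1, 2} M X"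
  have m: "mutual_info M (subsystem X {1}) (subsystem X {2}) = ?m"
    "mutual_info M (subsystem X {2}) (subsystem X {1}) = ?m"
    using mutual_info_split[of "{1}" "{1,2}" M X] mutual_info_split[of "{2}" "{1,2}" M X] D by simp_all
  have "mi_functional c {1, 2} M X =
      c {1, 2} {1} * mutual_info M (subsystem X {1}) (subsystem X {2}) +
      c {1, 2} {2} * mutual_info M (subsystem X {2}) (subsystem X {1})"
    using D by (simp add: mi_functional_def Pow_insert mutual_info_subsystem_empty[OF M])
  then show ?thesis unfolding I m sym by simp
qed

lemma add_mod_cancel:
  assumes "(a + b) mod d = (a + b') mod d" "b < d" "b' < (d::nat)"
  shows "b = b'"
proof -
  have "b \<le> b'" if "(a + b) mod d = (a + b') mod d" "b < d" "b' < d" for b b'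
  proof (rule ccontr)
    assume "\<not> b \<le> b'"
    then have "a + b' \<le> a + b" "b' < b" by auto
    from mod_eq_nat1E[OF that(1) this(1)] obtain q where "a + b = a + b' + d * q" .
    with \<open>b' < b\<close> \<open>b < d\<close> show False by (cases q) auto
  qed
  from this[of b b'] this[of b' b] assms show ?thesis by auto
qed

text \<open>Additivity of entropy for a product distribution; the reductions modulo \<open>d\<close> only keep the
range finite.\<close>

lemma entropy_pair_pmf:
  assumes p: "set_pmf p \<subseteq> {..<d}" and q: "set_pmf q \<subseteq> {..<d}" and d: "d \<ge> 1"
  shows "shannon_entropy (measure_pmf (pair_pmf p q)) (\<lambda>\<omega>. (fst \<omega> mod d, snd \<omega> mod d)) =
    pmf_entropy d p + pmf_entropy d q"
proof -
  let ?X = "\<lambda>\<omega>::nat \<times> nat. (fst \<omega> mod d, snd \<omega> mod d)" and ?A = "{..<d} \<times> {..<d}"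
  have fin: "finite (range ?X)" using d by (intro finite_subset[of "range ?X" ?A]) auto
  have "map_pmf ?X (pair_pmf p q) = map_pmf (\<lambda>\<omega>. \<omega>) (pair_pmf p q)"
    using p q by (intro map_pmf_cong) auto
  then have map: "map_pmf ?X (pair_pmf p q) = pair_pmf p q" by simp
  have sum1: "(\<Sum>a<d. pmf p a) = 1" "(\<Sum>a<d. pmf q a) = 1"
    using p q by (auto intro: sum_pmf_eq_1)
  have "pmf p a * pmf q b * ln (pmf p a * pmf q b) =
      pmf p a * ln (pmf p a) * pmf q b + pmf p a * (pmf q b * ln (pmf q b))" for a b
    by (cases "pmf p a = 0 \<or> pmf q b = 0") (auto simp: ln_mult pmf_positive_iff algebra_simps)
  then have "(\<Sum>(a, b)\<in>?A. pmf p a * pmf q b * ln (pmf p a * pmf q b)) =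
      (\<Sum>a<d. pmf p a * ln (pmf p a)) * (\<Sum>b<d. pmf q b) + (\<Sum>a<d. pmf p a) * (\<Sum>b<d. pmf q b * ln (pmf q b))"
    by (simp add: sum.cartesian_product[symmetric] sum.distrib sum_product)
  moreover have "shannon_entropy (measure_pmf (pair_pmf p q)) ?X =
      - (\<Sum>\<omega>\<in>?A. pmf (pair_pmf p q) \<omega> * ln (pmf (pair_pmf p q) \<omega>))"
    using shannon_entropy_pmf[OF fin, of ?A "pair_pmf p q"] p q unfolding map by auto
  moreover have "pmf (pair_pmf p q) \<omega> = pmf p (fst \<omega>) * pmf q (snd \<omega>)" for \<omega>
    by (cases \<omega>) (simp add: pmf_pair)
  ultimately show ?thesis
    by (simp add: pmf_entropy_def sum1 case_prod_unfold)
qed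

text \<open>The pair is \<open>(a, a + b)\<close> modulo \<open>d\<close> with \<open>a\<close> and \<open>b\<close> independent of distributions \<open>p\<close> and \<open>q\<close>. If
\<open>a + b\<close> again has distribution \<open>p\<close>, the pair has entropy \<open>H p + H q\<close> and mutual information
\<open>H p - H q\<close>. For \<open>x \<le> 1/2\<close> take \<open>b = 0\<close>, for \<open>x > 1/2\<close> take \<open>a\<close> uniform.\<close>

lemma two_coordinate_law:
  assumes c: "intricacy c" and d: "d \<ge> 2" and x: "x \<in> {0..1}"
  shows "\<exists>\<mu>\<in>laws d {1..2}. entropy_law {1..2} \<mu> = x * real 2 * ln (real d) \<and>
    mi_functional_law c {1..2} \<mu> = 2 * c {1..2} {1} * (2 * min x (1 - x) * ln (real d))"
proof -
  have cs: "coefficient_system c" using c by (simp add: intricacy_def)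
  have ne: "{..<d} \<noteq> {}" using d by (auto simp: lessThan_empty_iff)
  have lnd: "0 < ln (real d)" using d by simp
  have main: ?thesis
    if p: "set_pmf p \<subseteq> {..<d}" and q: "set_pmf q \<subseteq> {..<d}"
      and s: "map_pmf (\<lambda>\<omega>. (fst \<omega> + snd \<omega>) mod d) (pair_pmf p q) = p"
      and H: "pmf_entropy d p + pmf_entropy d q = 2 * x * ln (real d)"
        "pmf_entropy d p - pmf_entropy d q = 2 * min x (1 - x) * ln (real d)" for p q
  proof -
    let ?M = "measure_pmf (pair_pmf p q)"
    define X :: "nat \<Rightarrow> nat \<times> nat \<Rightarrow> nat"
      where "X i \<omega> = (if i = 1 then fst \<omega> mod d else (fst \<omega> + snd \<omega>) mod d)" for i \<omega>
    have lt: "X i \<omega> < d" for i \<omega> using d by (simp add: X_def)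
    have X: "system d {1..2} ?M X" by (rule system_measure_pmf) (rule lt)
    have fst: "map_pmf (\<lambda>\<omega>. fst \<omega> mod d) (pair_pmf p q) = p"
      using map_pmf_mod[OF p] map_fst_pair_pmf[of p q] map_pmf_comp[of "\<lambda>a. a mod d" fst "pair_pmf p q"]
      by simp
    have H1: "system_entropy {1} ?M X = pmf_entropy d p"
      using shannon_entropy_pmf_nat[OF finite_range_less[of "X 1" d, OF lt], of "pair_pmf p q" p d] fst p
      by (simp add: system_entropy_singleton X_def[abs_def])
    have H2: "system_entropy {2} ?M X = pmf_entropy d p"
      using shannon_entropy_pmf_nat[OF finite_range_less[of "X 2" d, OF lt], of "pair_pmf p q" p d] s p
      by (simp add: system_entropy_singleton X_def[abs_def])
    let ?f = "\<lambda>\<omega>. \<lambda>i\<in>{1..2::nat}. if i = 1 then fst \<omega> else (fst \<omega> + snd \<omega>) mod d"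
    let ?B = "\<lambda>\<omega>::nat \<times> nat. (fst \<omega> mod d, snd \<omega> mod d)"
    have "inj_on ?f (?B ` space ?M)"
    proof (rule inj_onI)
      fix v w assume vw: "v \<in> ?B ` space ?M" "w \<in> ?B ` space ?M" "?f v = ?f w"
      from fun_cong[OF vw(3), of 1] have 1: "fst v = fst w" by simp
      from fun_cong[OF vw(3), of 2] have "(fst v + snd v) mod d = (fst w + snd w) mod d" by simp
      moreover have "snd v < d" "snd w < d" using vw(1,2) d by auto
      ultimately have "snd v = snd w" using 1 add_mod_cancel by metis
      with 1 show "v = w" by (auto simp: prod_eq_iff)
    qed
    from shannon_entropy_inj[OF this]
    have "shannon_entropy ?M (\<lambda>\<omega>. ?f (?B \<omega>)) = pmf_entropy d p + pmf_entropy d q"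
      using entropy_pair_pmf[OF p q] d by simp
    moreover have "?f (?B \<omega>) = subsystem X {1..2} \<omega>" for \<omega>
      by (auto simp: subsystem_def X_def mod_simps fun_eq_iff)
    ultimately have H12: "system_entropy {1..2} ?M X = pmf_entropy d p + pmf_entropy d q"
      by (simp add: system_entropy_def)
    have fin: "finite {1..2::nat}" by simp
    have "mi_functional c {1..2} ?M X = 2 * c {1..2} {1} * (2 * min x (1 - x) * ln (real d))"
      using mi_functional_two[OF cs prob_space_measure_pmf, of "pair_pmf p q" X] H1 H2 H12 H(2) by simp
    then show ?thesis
      using law_in_laws[OF fin X] mi_functional_eq_law[OF fin X] H12 H(1)
      by (intro bexI[OF _ law_in_laws[OF fin X]]) simp
  qed
  show ?thesis
  proof (cases "x \<le> 1 / 2")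
    case True
    have "2 * x * ln (real d) \<le> 1 * ln (real d)" using True lnd by (intro mult_right_mono) auto
    then obtain p where p: "set_pmf p \<subseteq> {..<d}" "pmf_entropy d p = 2 * x * ln (real d)"
      using exists_pmf_entropy[of d "2 * x * ln (real d)"] d x lnd by auto
    have "pmf_entropy d (return_pmf 0) = 0"
      unfolding pmf_entropy_def by (simp add: indicator_def sum.neutral)
    moreover have "map_pmf (\<lambda>\<omega>. (fst \<omega> + snd \<omega>) mod d) (pair_pmf p (return_pmf 0)) = p"
      using map_pmf_mod[OF p(1)] by (simp add: pair_return_pmf2 map_pmf_comp)
    ultimately show ?thesis
      using p d True by (intro main[of p "return_pmf 0"]) auto
  next
    case False
    have "(2 * x - 1) * ln (real d) \<le> 1 * ln (real d)" using x lnd by (intro mult_right_mono) auto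
    then obtain q where q: "set_pmf q \<subseteq> {..<d}" "pmf_entropy d q = (2 * x - 1) * ln (real d)"
      using exists_pmf_entropy[of d "(2 * x - 1) * ln (real d)"] d False lnd by auto
    let ?u = "pmf_of_set {..<d}"
    have u: "pmf_entropy d ?u = ln (real d)"
      unfolding pmf_entropy_def using d ne by (simp add: ln_div)
    have shift: "map_pmf (\<lambda>a. (a + b) mod d) ?u = ?u" for b
    proof (rule map_pmf_of_set_bij_betw)
      show "bij_betw (\<lambda>a. (a + b) mod d) {..<d} {..<d}"
      proof (rule bij_betw_imageI)
        show inj: "inj_on (\<lambda>a. (a + b) mod d) {..<d}"
          by (rule inj_onI) (metis add.commute add_mod_cancel lessThan_iff)
        show "(\<lambda>a. (a + b) mod d) ` {..<d} = {..<d}"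
          using d by (intro endo_inj_surj inj) auto
      qed
    qed (use ne in auto)
    have "map_pmf (\<lambda>\<omega>. (fst \<omega> + snd \<omega>) mod d) (pair_pmf ?u q) =
        q \<bind> (\<lambda>b. map_pmf (\<lambda>a. (a + b) mod d) ?u)"
      by (subst pair_commute_pmf)
        (simp add: pair_pmf_def map_bind_pmf map_pmf_comp map_pmf_def[symmetric] bind_map_pmf)
    then have "map_pmf (\<lambda>\<omega>. (fst \<omega> + snd \<omega>) mod d) (pair_pmf ?u q) = ?u"
      by (simp add: shift)
    then show ?thesis
      using q u d ne x False by (intro main[of ?u q]) (auto simp: algebra_simps)
  qed
qed

section \<open>Approximately prescribed entropy\<close>

lemma bdd_above_near:
  assumes cs: "coefficient_system c" and d: "d \<ge> 2" and A: "A \<subseteq> systems d {1..N}"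
  shows "bdd_above ((\<lambda>(M, X). mi_functional c {1..N} M X) ` A)"
proof (rule bdd_aboveI2)
  fix s assume "s \<in> A"
  then have "system d {1..N} (fst s) (snd s)" using A by (auto simp: systems_def)
  from mi_functional_bounds(2)[OF cs _ this] d
  show "(case s of (M, X) \<Rightarrow> mi_functional c {1..N} M X) \<le> real N / 2 * ln (real d)"
    by (simp add: case_prod_unfold)
qed

text \<open>A law with its coordinate variables is a system, so the exact constraint is a special case of
the approximate one.\<close>

lemma max_intricacy_at_le_near:
  assumes c: "intricacy c" and d: "d \<ge> 2" and x: "x \<in> {0..1}" and N: "N \<ge> 1" and \<delta>: "\<delta> \<ge> 0"
  shows "max_intricacy_at c d N x \<le> max_intricacy_near c d N x \<delta>"
proof -
  have cs: "coefficient_system c" using c by (simp add: intricacy_def)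
  have lnd: "0 < ln (real d)" using d by simp
  have "{\<mu> \<in> laws d {1..N}. entropy_law {1..N} \<mu> = x * real N * ln (real d)} \<noteq> {}"
    using exists_law_entropy_fraction[OF c d x] by auto
  then show ?thesis
    unfolding max_intricacy_at_def
  proof (rule cSUP_least)
    fix \<mu> assume \<mu>: "\<mu> \<in> {\<mu> \<in> laws d {1..N}. entropy_law {1..N} \<mu> = x * real N * ln (real d)}"
    let ?S = "{(M, X)\<in>systems d {1..N}. \<bar>system_entropy {1..N} M X / (real N * ln (real d)) - x\<bar> \<le> \<delta>}"
    have "x * real N * ln (real d) / (real N * ln (real d)) = x" using N lnd by simp
    then have "(\<mu>, coords) \<in> ?S"
      using \<mu> \<delta> system_coords[of \<mu> d "{1..N}"] by (auto simp: systems_def entropy_law_def)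
    then have "(case (\<mu>, coords) of (M, X) \<Rightarrow> mi_functional c {1..N} M X) \<le> max_intricacy_near c d N x \<delta>"
      unfolding max_intricacy_near_def by (intro cSUP_upper bdd_above_near[OF cs d]) auto
    then show "mi_functional_law c {1..N} \<mu> \<le> max_intricacy_near c d N x \<delta>"
      by (simp add: mi_functional_law_def)
  qed
qed

lemma max_intricacy_near_le:
  assumes c: "intricacy c" and d: "d \<ge> 2" and x: "x \<in> {0..1}" and N: "N \<ge> 1" and \<delta>: "\<delta> \<ge> 0"
    and K: "\<And>(M :: (nat \<Rightarrow> nat) measure) X. system d {1..N} M X \<Longrightarrow>
      \<bar>system_entropy {1..N} M X - x * real N * ln (real d)\<bar> \<le> \<delta> * real N * ln (real d) \<Longrightarrow>
      mi_functional c {1..N} M X \<le> K"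
  shows "max_intricacy_near c d N x \<delta> \<le> K"
  unfolding max_intricacy_near_def
proof (rule cSUP_least)
  have lnd: "0 < ln (real d)" using d by simp
  let ?S = "{(M, X)\<in>systems d {1..N}. \<bar>system_entropy {1..N} M X / (real N * ln (real d)) - x\<bar> \<le> \<delta>}"
  obtain \<mu> where \<mu>: "\<mu> \<in> laws d {1..N}" "entropy_law {1..N} \<mu> = x * real N * ln (real d)"
    using exists_law_entropy_fraction[OF c d x] by auto
  have "x * real N * ln (real d) / (real N * ln (real d)) = x" using N lnd by simp
  then have "(\<mu>, coords) \<in> ?S"
    using \<mu> \<delta> system_coords[of \<mu> d "{1..N}"] by (auto simp: systems_def entropy_law_def)
  then show "?S \<noteq> {}" by blast
  fix s assume s: "s \<in> ?S"
  obtain M X where [simp]: "s = (M, X)" by (cases s)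
  have pos: "0 < real N * ln (real d)" using N lnd by simp
  have "\<bar>system_entropy {1..N} M X / (real N * ln (real d)) - x\<bar> * (real N * ln (real d))
      \<le> \<delta> * (real N * ln (real d))"
    using s pos by (intro mult_right_mono) auto
  moreover have "\<bar>system_entropy {1..N} M X / (real N * ln (real d)) - x\<bar> * (real N * ln (real d)) =
      \<bar>(system_entropy {1..N} M X / (real N * ln (real d)) - x) * (real N * ln (real d))\<bar>"
    using lnd by (simp add: abs_mult)
  moreover have "(system_entropy {1..N} M X / (real N * ln (real d)) - x) * (real N * ln (real d)) =
      system_entropy {1..N} M X - x * real N * ln (real d)"
    using N lnd by (simp add: left_diff_distrib)
  ultimately have "\<bar>system_entropy {1..N} M X - x * real N * ln (real d)\<bar> \<le> \<delta> * real N * ln (real d)"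
    by (simp add: mult.assoc)
  then show "(case s of (M, X) \<Rightarrow> mi_functional c {1..N} M X) \<le> K"
    using K s by (simp add: systems_def)
qed

text \<open>Appending \<open>m\<close> independent coordinates of total entropy
\<open>x (N + m) ln d - H\<close>, where \<open>H\<close> is the entropy of the given system, corrects the entropy to the
exact value. The condition on \<open>m\<close> says precisely that this amount lies between \<open>0\<close> and
\<open>m ln d\<close> whatever the sign of the deviation.\<close>

lemma near_le_padded:
  assumes c: "intricacy c" and d: "d \<ge> 2" and x: "x \<in> {0..1}" and N: "N \<ge> 1" and \<delta>: "\<delta> \<ge> 0"
    and m: "\<delta> * real N \<le> min x (1 - x) * real m"
    and L: "\<And>n. max_intricacy_at c d n x \<le> L * real n"
  shows "max_intricacy_near c d N x \<delta> \<le> L * real (N + m)"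
proof (rule max_intricacy_near_le[OF c d x N \<delta>])
  fix M :: "(nat \<Rightarrow> nat) measure" and X
  assume X: "system d {1..N} M X"
    and close: "\<bar>system_entropy {1..N} M X - x * real N * ln (real d)\<bar> \<le> \<delta> * real N * ln (real d)"
  have cs: "coefficient_system c" using c by (simp add: intricacy_def)
  have lnd: "0 < ln (real d)" using d by simp
  define h where "h = x * real (N + m) * ln (real d) - system_entropy {1..N} M X"
  have "\<delta> * real N \<le> x * real m" "\<delta> * real N \<le> (1 - x) * real m"
    by (rule order_trans[OF m], rule mult_right_mono, simp, simp)+
  then have "\<delta> * real N * ln (real d) \<le> x * real m * ln (real d)"
    "\<delta> * real N * ln (real d) \<le> (1 - x) * real m * ln (real d)"
    using lnd by (auto intro!: mult_right_mono)
  then have "0 \<le> h" "h \<le> real m * ln (real d)"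
    using close by (auto simp: h_def algebra_simps abs_le_iff)
  from exists_law_entropy[OF c d this] obtain \<nu> where
    \<nu>: "\<nu> \<in> laws d {1..m}" "entropy_law {1..m} \<nu> = h" by auto
  obtain \<rho> where \<rho>: "\<rho> \<in> laws d {1..N + m}"
    "mi_functional_law c {1..N + m} \<rho> = mi_functional c {1..N} M X + mi_functional_law c {1..m} \<nu>"
    "entropy_law {1..N + m} \<rho> = system_entropy {1..N} M X + h"
    using concatenate_laws[OF c d X system_coords[OF \<nu>(1)]] \<nu>(2)
    by (auto simp: mi_functional_law_def entropy_law_def)
  have "mi_functional c {1..N} M X \<le> mi_functional_law c {1..N + m} \<rho>"
    using \<rho>(2) law_bounds(1)[OF cs d \<nu>(1)] by simp
  also have "\<dots> \<le> max_intricacy_at c d (N + m) x"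
    using \<rho>(3) by (intro max_intricacy_at_upper[OF c d \<rho>(1)]) (simp add: h_def)
  also have "\<dots> \<le> L * real (N + m)" by (rule L)
  finally show "mi_functional c {1..N} M X \<le> L * real (N + m)" .
qed

text \<open>At the end points no padding can correct the entropy, but there the intricacy itself is bounded by
the deviation of the entropy from its extreme value.\<close>

lemma near_le_boundary:
  assumes c: "intricacy c" and d: "d \<ge> 2" and x: "x \<in> {0, 1}" and N: "N \<ge> 1" and \<delta>: "\<delta> \<ge> 0"
  shows "max_intricacy_near c d N x \<delta> \<le> \<delta> * real N * ln (real d)"
proof (rule max_intricacy_near_le[OF c d _ N \<delta>])
  show "x \<in> {0..1}" using x by auto
  fix M :: "(nat \<Rightarrow> nat) measure" and X
  assume X: "system d {1..N} M X"
    and close: "\<bar>system_entropy {1..N} M X - x * real N * ln (real d)\<bar> \<le> \<delta> * real N * ln (real d)"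
  have cs: "coefficient_system c" using c by (simp add: intricacy_def)
  show "mi_functional c {1..N} M X \<le> \<delta> * real N * ln (real d)"
    using mi_functional_bounds(3,4)[OF cs _ X] d x close by (auto simp: abs_le_iff)
qed

lemma max_intricacy_near_limit:
  assumes c: "intricacy c" and d: "d \<ge> 2" and x: "x \<in> {0..1}"
    and \<delta>: "\<And>N. N \<ge> 1 \<Longrightarrow> \<delta> N \<ge> 0" "\<delta> \<longlonglongrightarrow> 0"
    and L: "(\<lambda>n. max_intricacy_at c d n x / real n) \<longlonglongrightarrow> L"
      "\<And>n. max_intricacy_at c d n x \<le> L * real n"
  shows "(\<lambda>N. max_intricacy_near c d N x (\<delta> N) / real N) \<longlonglongrightarrow> L"
proof -
  have "0 \<le> max_intricacy_at c d 1 x"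
  proof -
    obtain \<mu> where "\<mu> \<in> laws d {1..1}" "entropy_law {1..1} \<mu> = x * real 1 * ln (real d)"
      using exists_law_entropy_fraction[OF c d x] by blast
    then show ?thesis
      using max_intricacy_at_upper[OF c d, of \<mu> 1 x] law_bounds(1)[of c d \<mu> 1] c d
      by (auto simp: intricacy_def)
  qed
  then have L0: "L \<ge> 0" using L(2)[of 1] by simp
  have lower: "eventually (\<lambda>N. max_intricacy_at c d N x / real N \<le> max_intricacy_near c d N x (\<delta> N) / real N) sequentially"
    using max_intricacy_at_le_near[OF c d x _ \<delta>(1)]
    by (intro eventually_sequentiallyI[of 1] divide_right_mono) auto
  show ?thesis
  proof (cases "x \<in> {0, 1}")
    case True
    show ?thesis
    proof (rule tendsto_sandwich[OF lower])
      show "eventually (\<lambda>N. max_intricacy_near c d N x (\<delta> N) / real N \<le> \<delta> N * ln (real d) + L) sequentially"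
      proof (rule eventually_sequentiallyI[of 1])
        fix N :: nat assume N: "1 \<le> N"
        have "max_intricacy_near c d N x (\<delta> N) / real N \<le> \<delta> N * real N * ln (real d) / real N"
          by (rule divide_right_mono[OF near_le_boundary[OF c d True N \<delta>(1)[OF N]]]) simp
        also have "\<dots> = \<delta> N * ln (real d)" using N by simp
        finally show "max_intricacy_near c d N x (\<delta> N) / real N \<le> \<delta> N * ln (real d) + L"
          using L0 by simp
      qed
      have "(\<lambda>N. \<delta> N * ln (real d) + L) \<longlonglongrightarrow> 0 * ln (real d) + L" by (intro tendsto_intros \<delta>)
      then show "(\<lambda>N. \<delta> N * ln (real d) + L) \<longlonglongrightarrow> L" by simp
    qed (rule L)
next
  case False
  define m where "m = min x (1 - x)"
  have m: "0 < m" using False x by (auto simp: m_def min_def)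
  \<comment> \<open>The number of appended coordinates: the least integer that the padding argument permits.\<close>
  define k where "k N = nat \<lceil>\<delta> N * real N / m\<rceil>" for N
  have k: "\<delta> N * real N \<le> m * real (k N)" "real (k N) \<le> \<delta> N * real N / m + 1" if "N \<ge> 1" for N
  proof -
    have nn: "0 \<le> \<delta> N * real N / m" using \<delta>(1)[OF that] m by simp
    have "\<delta> N * real N / m \<le> real (k N)" unfolding k_def by (rule real_nat_ceiling_ge)
    then show "\<delta> N * real N \<le> m * real (k N)" using m by (simp add: field_simps)
    show "real (k N) \<le> \<delta> N * real N / m + 1"
      unfolding k_def using nn by linarith
  qed
  show ?thesis
  proof (rule tendsto_sandwich[OF lower])
    show "eventually (\<lambda>N. max_intricacy_near c d N x (\<delta> N) / real N \<le> L * (1 + (\<delta> N / m + 1 / real N))) sequentially"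
    proof (rule eventually_sequentiallyI[of 1])
      fix N :: nat assume N: "1 \<le> N"
      have "max_intricacy_near c d N x (\<delta> N) \<le> L * real (N + k N)"
        using k(1)[OF N] by (intro near_le_padded[OF c d x N \<delta>(1)[OF N] _ L(2)]) (simp add: m_def)
      also have "\<dots> \<le> L * (real N + (\<delta> N * real N / m + 1))"
        using k(2)[OF N] L0 by (intro mult_left_mono) auto
      finally have "max_intricacy_near c d N x (\<delta> N) / real N \<le> L * (real N + (\<delta> N * real N / m + 1)) / real N"
        by (rule divide_right_mono) simp
      also have "\<dots> = L * (1 + (\<delta> N / m + 1 / real N))"
        using N m by (simp add: field_simps)
      finally show "max_intricacy_near c d N x (\<delta> N) / real N \<le> L * (1 + (\<delta> N / m + 1 / real N))" .
    qed
    have "(\<lambda>N. L * (1 + (\<delta> N / m + 1 / real N))) \<longlonglongrightarrow> L * (1 + (0 / m + 0))"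
      using m by (intro tendsto_intros \<delta> lim_1_over_n) auto
    then show "(\<lambda>N. L * (1 + (\<delta> N / m + 1 / real N))) \<longlonglongrightarrow> L" by simp
  qed (rule L)
  qed
qed

section \<open>The Hausdorff moment problem\<close>

lemma unit_interval_measure:
  assumes "sets \<nu> = sets (restrict_space borel {0..1::real})"
  shows "space \<nu> = {0..1}" "f \<in> borel_measurable borel \<Longrightarrow> f \<in> borel_measurable \<nu>"
proof -
  show "space \<nu> = {0..1}" using sets_eq_imp_space_eq[OF assms] by (simp add: space_restrict_space)
  show "f \<in> borel_measurable \<nu>" if "f \<in> borel_measurable borel"
    using measurable_restrict_space1[OF that] unfolding measurable_cong_sets[OF assms refl] .
qed

lemma integrable_unit_interval:
  assumes "prob_space \<nu>" "sets \<nu> = sets (restrict_space borel {0..1::real})"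
  shows "integrable \<nu> (\<lambda>x. x ^ a * (1 - x) ^ b)"
proof -
  interpret prob_space \<nu> by fact
  have "\<bar>x ^ a * (1 - x) ^ b\<bar> \<le> 1" if "x \<in> {0..1}" for x :: real
    using that by (auto simp: abs_mult power_abs intro!: mult_le_one power_le_one)
  then show ?thesis
    by (intro integrable_const_bound[where B = 1] AE_I2 unit_interval_measure(2)[OF assms(2)])
      (auto simp: unit_interval_measure(1)[OF assms(2)])
qed

text \<open>Both sides are products of \<open>j\<close> factors, \<open>(k - i) / (n - i)\<close> and \<open>k / n\<close>, of modulus at most
one. The difference of the products is at most the sum of the differences of the factors. The
hypothesis \<open>2 * j \<le> n\<close> keeps \<open>(k - i) / (n - i)\<close> above \<open>-1\<close> when \<open>k < i\<close>.\<close>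

lemma binomial_ratio_close:
  assumes k: "k \<le> n" and n: "2 * j \<le> n"
  shows "\<bar>real (k choose j) / real (n choose j) - (real k / real n) ^ j\<bar> \<le> real j * (real j / (real n - real j))"
proof (cases "j = 0")
  case False
  then have n0: "n > 0" and jn: "j < n" using n by auto
  define z w where "z i = (real k - real i) / (real n - real i)" and "w i = real k / real n" for i :: nat
  have "real (k choose j) / real (n choose j) = (\<Prod>i = 0..<j. z i)"
    by (simp add: binomial_gbinomial gbinomial_prod_rev prod_dividef z_def)
  moreover have "(real k / real n) ^ j = (\<Prod>i = 0..<j. w i)" by (simp add: w_def)
  moreover have "norm ((\<Prod>i = 0..<j. z i) - (\<Prod>i = 0..<j. w i)) \<le> (\<Sum>i = 0..<j. norm (z i - w i))"
  proof (rule norm_prod_diff)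
    fix i assume i: "i \<in> {0..<j}"
    show "norm (z i) \<le> 1" using i k n by (auto simp: z_def divide_simps)
    show "norm (w i) \<le> 1" using k by (auto simp: w_def divide_simps)
  qed
  moreover have "(\<Sum>i = 0..<j. norm (z i - w i)) \<le> (\<Sum>i = 0..<j. real j / (real n - real j))"
  proof (rule sum_mono)
    fix i assume i: "i \<in> {0..<j}"
    have pos: "0 < real n - real i" using i jn by simp
    have "z i - w i = - (real i * (real n - real k) / (real n * (real n - real i)))"
      using pos n0 unfolding z_def w_def by (simp add: divide_simps) (simp add: algebra_simps)
    then have "norm (z i - w i) = (real i / (real n - real i)) * ((real n - real k) / real n)"
      using pos k by (simp add: mult.commute)
    also have "\<dots> \<le> (real j / (real n - real j)) * 1"
      using i jn k n0 by (intro mult_mono frac_le) auto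
    finally show "norm (z i - w i) \<le> real j / (real n - real j)" by simp
  qed
  ultimately show ?thesis by simp
qed simp

text \<open>Composing with the retraction of the line onto the unit interval turns powers into bounded
continuous functions, to which weak convergence applies. It also pushes the weak limit onto the
interval without an argument about its support.\<close>

definition clamp01 :: "real \<Rightarrow> real" where
  "clamp01 x = max 0 (min 1 x)"

lemma clamp01: "clamp01 x \<in> {0..1}" "x \<in> {0..1} \<Longrightarrow> clamp01 x = x"
  by (auto simp: clamp01_def)

text \<open>Let \<open>k\<close> be distributed according to \<open>p n\<close>. The ratio of \<open>k choose j\<close> to \<open>n choose j\<close> has mean
\<open>m j\<close> and differs from \<open>(k / n) ^ j\<close> by \<open>O(1 / n)\<close>, so the moments of \<open>k / n\<close> converge to
\<open>m\<close>. All these laws live on the unit interval, hence are tight, and any weak limit point has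
the moments \<open>m\<close>.\<close>

lemma moment_measure_exists:
  fixes p :: "nat \<Rightarrow> nat pmf" and m :: "nat \<Rightarrow> real"
  assumes supp: "\<And>n. set_pmf (p n) \<subseteq> {..n}"
    and fact: "\<And>n j. j \<le> n \<Longrightarrow>
      measure_pmf.expectation (p n) (\<lambda>k. real (k choose j)) = real (n choose j) * m j"
  shows "\<exists>\<nu>. prob_space \<nu> \<and> sets \<nu> = sets (restrict_space borel {0..1::real}) \<and>
    (\<forall>j. (\<integral>x. x ^ j \<partial>\<nu>) = m j)"
proof -
  define \<mu> where "\<mu> n = distr (measure_pmf (p n)) borel (\<lambda>k. real k / real n)" for n
  have \<mu>: "real_distribution (\<mu> n)" for n
    unfolding \<mu>_def by (rule prob_space.real_distribution_distr[OF prob_space_measure_pmf]) simp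
  have in01: "real k / real n \<in> {0..1}" if "k \<in> set_pmf (p n)" for k n
    using supp that by (force simp: divide_simps)
  have "measure (\<mu> n) {-1<..1} = 1" for n
  proof -
    have "AE k in measure_pmf (p n). k \<in> (\<lambda>k. real k / real n) -` {-1<..1}"
      using in01 by (intro AE_pmfI) (auto intro: order.strict_trans2[of "-1" 0])
    then have "measure (measure_pmf (p n)) ((\<lambda>k. real k / real n) -` {-1<..1}) = 1"
      by (subst measure_pmf.prob_eq_1) auto
    then show ?thesis unfolding \<mu>_def by (subst measure_distr) auto
  qed
  then have "tight \<mu>"
    unfolding tight_def using \<mu>
    by (intro conjI allI impI exI[of _ "-1 :: real"] exI[of _ "1 :: real"]) auto
  from tight_imp_convergent_subsubsequence[OF this strict_mono_id]
  obtain r Q where r: "strict_mono (r :: nat \<Rightarrow> nat)" and Q: "real_distribution Q"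
    and conv: "weak_conv_m (\<mu> \<circ> r) Q" by auto
  interpret Q: real_distribution Q by (rule Q)
  have moments: "(\<lambda>n. \<integral>x. clamp01 x ^ j \<partial>\<mu> n) \<longlonglongrightarrow> m j" for j
  proof -
    define e where "e n = real j * (real j / (real n - real j))" for n
    have "(\<lambda>n. real j / (real n - real j)) \<longlonglongrightarrow> 0"
      by (intro tendsto_divide_0[OF tendsto_const] filterlim_at_top_imp_at_infinity
          filterlim_tendsto_add_at_top[of "\<lambda>_. - real j" "- real j" _ real, simplified]
          filterlim_real_sequentially)
    from tendsto_mult[OF tendsto_const[of "real j"] this] have e0: "e \<longlonglongrightarrow> 0"
      by (simp add: e_def[abs_def])
    have "\<bar>(\<integral>x. clamp01 x ^ j \<partial>\<mu> n) - m j\<bar> \<le> e n" if n: "n \<ge> 2 * j" for n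
    proof -
      have fin: "finite (set_pmf (p n))" using supp by (rule finite_subset) simp
      have int: "integrable (measure_pmf (p n)) f" for f :: "nat \<Rightarrow> real"
        by (rule integrable_measure_pmf_finite[OF fin])
      have "(\<integral>x. clamp01 x ^ j \<partial>\<mu> n) = measure_pmf.expectation (p n) (\<lambda>k. clamp01 (real k / real n) ^ j)"
        unfolding \<mu>_def clamp01_def by (subst integral_distr) auto
      also have "\<dots> = measure_pmf.expectation (p n) (\<lambda>k. (real k / real n) ^ j)"
        using clamp01(2)[OF in01] by (intro integral_cong_AE) (auto intro!: AE_pmfI)
      finally have 1: "(\<integral>x. clamp01 x ^ j \<partial>\<mu> n) = measure_pmf.expectation (p n) (\<lambda>k. (real k / real n) ^ j)" .
      have "real (n choose j) > 0" using n by simp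
      then have 2: "m j = measure_pmf.expectation (p n) (\<lambda>k. real (k choose j) / real (n choose j))"
        using fact[of j n] n by (simp add: field_simps)
      have "\<bar>m j - (\<integral>x. clamp01 x ^ j \<partial>\<mu> n)\<bar> =
          \<bar>measure_pmf.expectation (p n) (\<lambda>k. real (k choose j) / real (n choose j) - (real k / real n) ^ j)\<bar>"
        unfolding 1 2 by (subst Bochner_Integration.integral_diff[OF int int]) simp
      also have "\<dots> \<le> measure_pmf.expectation (p n) (\<lambda>k. \<bar>real (k choose j) / real (n choose j) - (real k / real n) ^ j\<bar>)"
        by (rule integral_abs_bound)
      also have "\<dots> \<le> measure_pmf.expectation (p n) (\<lambda>k. e n)"
        using supp[of n] n binomial_ratio_close unfolding e_def
        by (intro integral_mono_AE int AE_pmfI) auto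
      finally show ?thesis by (simp add: abs_minus_commute)
    qed
    then have "(\<lambda>n. (\<integral>x. clamp01 x ^ j \<partial>\<mu> n) - m j) \<longlonglongrightarrow> 0"
      by (intro Lim_null_comparison[OF eventually_sequentiallyI[of "2 * j"] e0]) simp
    then show ?thesis by (simp add: LIM_zero_iff)
  qed
  have Qmom: "(\<integral>x. clamp01 x ^ j \<partial>Q) = m j" for j
  proof (rule LIMSEQ_unique)
    show "(\<lambda>n. \<integral>x. clamp01 x ^ j \<partial>(\<mu> \<circ> r) n) \<longlonglongrightarrow> (\<integral>x. clamp01 x ^ j \<partial>Q)"
    proof (rule weak_conv_imp_integral_bdd_continuous_conv[OF _ Q conv])
      show "real_distribution ((\<mu> \<circ> r) n)" for n using \<mu> by simp
      show "isCont (\<lambda>x. clamp01 x ^ j) x" for x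
        unfolding clamp01_def by (intro continuous_intros)
      show "norm (clamp01 x ^ j) \<le> 1" for x
        using clamp01(1)[of x] by (simp add: power_le_one)
    qed
    show "(\<lambda>n. \<integral>x. clamp01 x ^ j \<partial>(\<mu> \<circ> r) n) \<longlonglongrightarrow> m j"
      using LIMSEQ_subseq_LIMSEQ[OF moments r] by (simp add: comp_def)
  qed
  let ?R = "restrict_space borel {0..1::real}"
  have cm: "clamp01 \<in> measurable Q ?R"
    using clamp01(1) unfolding clamp01_def[abs_def] by (intro measurable_restrict_space2) auto
  have pm: "(\<lambda>x. x ^ j) \<in> borel_measurable ?R" for j
    by (intro measurable_restrict_space1) simp
  have "(\<integral>x. x ^ j \<partial>distr Q ?R clamp01) = m j" for j
    using integral_distr[OF cm pm] Qmom by simp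
  then show ?thesis
    using Q.prob_space_distr[OF cm] by (intro exI[of _ "distr Q ?R clamp01"]) simp
qed

text \<open>On the unit interval all moments are at most one, so the characteristic function is the sum of
its Taylor series, whose coefficients are the moments; then Levy's uniqueness theorem applies.\<close>

lemma moments_determine:
  assumes \<nu>1: "prob_space \<nu>1" "sets \<nu>1 = sets (restrict_space borel {0..1::real})"
    and \<nu>2: "prob_space \<nu>2" "sets \<nu>2 = sets (restrict_space borel {0..1::real})"
    and eq: "\<And>k. (\<integral>x. x ^ k \<partial>\<nu>1) = (\<integral>x. x ^ k \<partial>\<nu>2)"
  shows "\<nu>1 = \<nu>2"
proof -
  \<comment> \<open>The uniqueness theorem concerns measures on the whole line, so extend both by zero.\<close>
  define B where "B \<nu> = distr \<nu> borel (\<lambda>x. x)" for \<nu> :: "real measure"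
  have main: "real_distribution (B \<nu>) \<and> (\<forall>k. (\<integral>x. x ^ k \<partial>B \<nu>) = (\<integral>x. x ^ k \<partial>\<nu>)) \<and>
      (\<forall>A\<in>sets \<nu>. emeasure \<nu> A = emeasure (B \<nu>) A) \<and>
      (\<lambda>n. \<Sum>k\<le>n. ((\<i> * t) ^ k / fact k) * complex_of_real (\<integral>x. x ^ k \<partial>\<nu>)) \<longlonglongrightarrow> char (B \<nu>) t"
    if \<nu>: "prob_space \<nu>" "sets \<nu> = sets (restrict_space borel {0..1::real})" for \<nu> t
  proof -
    interpret prob_space \<nu> by fact
    note sp = unit_interval_measure(1)[OF \<nu>(2)] and meas = unit_interval_measure(2)[OF \<nu>(2)]
    have id: "(\<lambda>x. x) \<in> borel_measurable \<nu>" by (rule meas) simp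
    have BD: "real_distribution (B \<nu>)" unfolding B_def using id by simp
    interpret B: real_distribution "B \<nu>" by (rule BD)
    have mom: "(\<integral>x. x ^ k \<partial>B \<nu>) = (\<integral>x. x ^ k \<partial>\<nu>)" for k
      unfolding B_def by (subst integral_distr[OF id]) auto
    have "AE x in \<nu>. \<bar>x\<bar> \<le> 1" by (intro AE_I2) (auto simp: sp)
    then have ae: "AE x in B \<nu>. \<bar>x\<bar> \<le> 1"
      unfolding B_def by (subst AE_distr_iff[OF id]) auto
    have ae': "AE x in B \<nu>. norm (\<bar>x\<bar> ^ k) \<le> 1" for k
      using ae by eventually_elim (simp add: power_abs power_le_one)
    have int: "integrable (B \<nu>) (\<lambda>x. \<bar>x\<bar> ^ k)" "integrable (B \<nu>) (\<lambda>x. x ^ k)" for k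
      using ae'[of k] by (auto intro!: B.integrable_const_bound[where B = 1] simp: power_abs)
    have le1: "B.expectation (\<lambda>x. \<bar>x\<bar> ^ n) \<le> 1" for n
    proof -
      have "B.expectation (\<lambda>x. \<bar>x\<bar> ^ n) \<le> B.expectation (\<lambda>x. 1)"
        using ae'[of n] by (intro integral_mono_AE int) auto
      then show ?thesis using B.prob_space by simp
    qed
    have "(\<lambda>n. (\<Sum>k\<le>n. ((\<i> * t) ^ k / fact k) * B.expectation (\<lambda>x. x ^ k)) - char (B \<nu>) t) \<longlonglongrightarrow> 0"
    proof (rule Lim_null_comparison[OF always_eventually])
      have "(\<lambda>n. 2 * (\<bar>t\<bar> ^ n / fact n)) \<longlonglongrightarrow> 2 * 0"
        using summable_LIMSEQ_zero[OF summable_exp[of "\<bar>t\<bar>"]]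
        by (intro tendsto_intros) (simp add: divide_inverse mult.commute)
      then show "(\<lambda>n. 2 * \<bar>t\<bar> ^ n / fact n) \<longlonglongrightarrow> 0" by simp
      show "\<forall>n. norm ((\<Sum>k\<le>n. ((\<i> * t) ^ k / fact k) * B.expectation (\<lambda>x. x ^ k)) - char (B \<nu>) t)
          \<le> 2 * \<bar>t\<bar> ^ n / fact n"
      proof
        fix n
        have "norm (char (B \<nu>) t - (\<Sum>k\<le>n. ((\<i> * t) ^ k / fact k) * B.expectation (\<lambda>x. x ^ k)))
            \<le> 2 * \<bar>t\<bar> ^ n / fact n * B.expectation (\<lambda>x. \<bar>x\<bar> ^ n)"
          using B.char_approx1[of n t] int by simp
        also have "\<dots> \<le> 2 * \<bar>t\<bar> ^ n / fact n * 1"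
          by (intro mult_left_mono le1) auto
        finally show "norm ((\<Sum>k\<le>n. ((\<i> * t) ^ k / fact k) * B.expectation (\<lambda>x. x ^ k)) - char (B \<nu>) t)
            \<le> 2 * \<bar>t\<bar> ^ n / fact n" by (simp add: norm_minus_commute)
      qed
    qed
    then have "(\<lambda>n. \<Sum>k\<le>n. ((\<i> * t) ^ k / fact k) * B.expectation (\<lambda>x. x ^ k)) \<longlonglongrightarrow> char (B \<nu>) t"
      by (simp only: LIM_zero_iff)
    moreover have "emeasure \<nu> A = emeasure (B \<nu>) A" if A: "A \<in> sets \<nu>" for A
    proof -
      have "A \<in> sets borel" "A \<subseteq> {0..1}"
        using A \<nu>(2) by (auto simp: sets_restrict_space_iff)
      then show ?thesis unfolding B_def by (subst emeasure_distr[OF id]) (auto simp: sp Int_absorb2)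
    qed
    ultimately show ?thesis using BD mom by simp
  qed
  have "char (B \<nu>1) t = char (B \<nu>2) t" for t
    using LIMSEQ_unique[OF main[OF \<nu>1, of t, THEN conjunct2, THEN conjunct2, THEN conjunct2],
        of "char (B \<nu>2) t"] main[OF \<nu>2, of t] eq by simp
  then have "B \<nu>1 = B \<nu>2"
    using main[OF \<nu>1] main[OF \<nu>2] by (intro Levy_uniqueness) auto
  then show ?thesis
    using main[OF \<nu>1] main[OF \<nu>2] \<nu>1(2) \<nu>2(2) by (intro measure_eqI) auto
qed

section \<open>The coefficients of an intricacy as moments\<close>

text \<open>Uniqueness in Moebius inversion over the lattice of subsets, by descending induction on the
size of the set.\<close>

lemma up_sums_determine:
  fixes a b :: "'a set \<Rightarrow> real"
  assumes I: "finite I"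
    and eq: "\<And>K. K \<subseteq> I \<Longrightarrow> sum a {S. K \<subseteq> S \<and> S \<subseteq> I} = sum b {S. K \<subseteq> S \<and> S \<subseteq> I}"
    and S: "S \<subseteq> I"
  shows "a S = b S"
  using S
proof (induction "card (I - S)" arbitrary: S rule: less_induct)
  case less
  have fin: "finite {T. S \<subset> T \<and> T \<subseteq> I}"
    by (rule finite_subset[of _ "Pow I"]) (use I in auto)
  have split: "{T. S \<subseteq> T \<and> T \<subseteq> I} = insert S {T. S \<subset> T \<and> T \<subseteq> I}" using less.prems by auto
  have "a T = b T" if "T \<in> {T. S \<subset> T \<and> T \<subseteq> I}" for T
    using that less.prems I by (intro less.hyps psubset_card_mono) auto
  then have "sum a {T. S \<subset> T \<and> T \<subseteq> I} = sum b {T. S \<subset> T \<and> T \<subseteq> I}" by (rule sum.cong[OF refl])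
  then show ?case using eq[OF less.prems] fin by (simp add: split)
qed

definition coin :: "bool measure" where
  "coin = measure_pmf (bernoulli_pmf (1 / 2))"

text \<open>One fair bit, repeated at all indices in \<open>K\<close>; the remaining variables are constant. The sets
\<open>S\<close> and \<open>I - S\<close> share information exactly when both meet \<open>K\<close>.\<close>

definition coin_system :: "nat set \<Rightarrow> nat \<Rightarrow> bool \<Rightarrow> nat" where
  "coin_system K i b = (if i \<in> K \<and> b then 1 else 0)"

lemma prob_space_coin: "prob_space coin"
  by (simp add: coin_def prob_space_measure_pmf)

lemma system_coin: "system 2 I coin (coin_system K)"
  unfolding coin_def by (rule system_measure_pmf) (simp add: coin_system_def)

lemma shannon_entropy_const:
  assumes "prob_space M" shows "shannon_entropy M (\<lambda>_. a) = 0"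
proof -
  interpret prob_space M by fact
  have "(\<lambda>_. a) ` space M = {a}" using not_empty by auto
  then show ?thesis by (simp add: shannon_entropy_def prob_space)
qed

lemma system_entropy_coin:
  "system_entropy S coin (coin_system K) = (if S \<inter> K = {} then 0 else ln 2)"
proof -
  let ?f = "\<lambda>b. \<lambda>i\<in>S. if i \<in> K \<and> b then 1 else (0::nat)"
  have f: "subsystem (coin_system K) S = ?f"
    by (auto simp: subsystem_def coin_system_def)
  show ?thesis
  proof (cases "S \<inter> K = {}")
    case True
    then have "subsystem (coin_system K) S = (\<lambda>_. \<lambda>i\<in>S. 0)"
      unfolding f by (auto simp: fun_eq_iff restrict_def)
    then show ?thesis
      using True shannon_entropy_const[OF prob_space_coin] by (simp add: system_entropy_def)
  next
    case False
    then obtain i where i: "i \<in> S" "i \<in> K" by auto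
    have "inj_on ?f ((\<lambda>b. b) ` space coin)"
    proof (rule inj_onI)
      fix b b' assume "?f b = ?f b'"
      from fun_cong[OF this, of i] show "b = b'" using i by (auto split: if_splits)
    qed
    from shannon_entropy_inj[OF this]
    have "system_entropy S coin (coin_system K) = shannon_entropy coin (\<lambda>b. b)"
      by (simp add: system_entropy_def f)
    also have "\<dots> = ln 2"
      by (simp add: shannon_entropy_def coin_def UNIV_bool vimage_def measure_pmf_single ln_div)
    finally show ?thesis using False by simp
  qed
qed

text \<open>The probability that a random subset of \<open>I\<close>, chosen with weights \<open>c I\<close>, contains \<open>K\<close>.\<close>

definition up_sum :: "(nat set \<Rightarrow> nat set \<Rightarrow> real) \<Rightarrow> nat set \<Rightarrow> nat set \<Rightarrow> real" where
  "up_sum c I K = sum (c I) {S. K \<subseteq> S \<and> S \<subseteq> I}"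

lemma up_sum_Pow:
  assumes "finite I"
  shows "up_sum c I K = (\<Sum>S\<in>Pow I. if K \<subseteq> S then c I S else 0)"
proof -
  have "{S. K \<subseteq> S \<and> S \<subseteq> I} = {S \<in> Pow I. K \<subseteq> S}" by auto
  moreover have "finite (Pow I)" using assms by simp
  ultimately show ?thesis unfolding up_sum_def by (simp only: sum.inter_filter)
qed

text \<open>A term is \<open>ln 2\<close> if \<open>S\<close> separates \<open>K\<close> and zero otherwise. The exceptions are the sets that
contain \<open>K\<close> and those that miss it; these two disjoint events have equal weight by the symmetry
of the coefficients under complements.\<close>

lemma mi_functional_coin:
  assumes c: "coefficient_system c" and I: "finite_index_set I" and K: "K \<subseteq> I" "K \<noteq> {}"
  shows "mi_functional c I coin (coin_system K) = ln 2 * (1 - 2 * up_sum c I K)"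
proof -
  have fin: "finite I" using I by (simp add: finite_index_set_def)
  have one: "(\<Sum>S\<in>Pow I. c I S) = 1"
    and sym: "S \<subseteq> I \<Longrightarrow> c I (I - S) = c I S" for S
    using c I by (auto simp: coefficient_system_def)
  have IK: "I \<inter> K \<noteq> {}" using K by auto
  note up = up_sum_Pow[OF fin, of c K]
  have up': "up_sum c I K = (\<Sum>S\<in>Pow I. if S \<inter> K = {} then c I S else 0)"
    unfolding up
  proof (rule sum.reindex_bij_witness[where i = "\<lambda>S. I - S" and j = "\<lambda>S. I - S"])
    fix S assume S: "S \<in> Pow I"
    then show "I - (I - S) = S" "I - S \<in> Pow I" by auto
    have "(I - S) \<inter> K = {} \<longleftrightarrow> K \<subseteq> S" using K S by auto
    then show "(if (I - S) \<inter> K = {} then c I (I - S) else 0) = (if K \<subseteq> S then c I S else 0)"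
      using sym S by simp
  qed auto
  have "mi_functional c I coin (coin_system K) =
      (\<Sum>S\<in>Pow I. ln 2 * (c I S - (if K \<subseteq> S then c I S else 0) - (if S \<inter> K = {} then c I S else 0)))"
    unfolding mi_functional_def
  proof (rule sum.cong[OF refl])
    fix S assume S: "S \<in> Pow I"
    have "(I - S) \<inter> K = {} \<longleftrightarrow> K \<subseteq> S" using K S by auto
    moreover have "\<not> (K \<subseteq> S \<and> S \<inter> K = {})" using K by auto
    ultimately show "c I S * mutual_info coin (subsystem (coin_system K) S) (subsystem (coin_system K) (I - S)) =
        ln 2 * (c I S - (if K \<subseteq> S then c I S else 0) - (if S \<inter> K = {} then c I S else 0))"
      using S IK by (simp add: mutual_info_split system_entropy_coin)
  qed
  also have "\<dots> = ln 2 * (1 - up_sum c I K - up_sum c I K)"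
    by (subst (2) up', subst up) (simp add: sum_distrib_left[symmetric] sum_subtractf one)
  finally show ?thesis by simp
qed

lemma mi_functional_cong:
  assumes "\<And>i. i \<in> I \<Longrightarrow> X i = Y i"
  shows "mi_functional c I M X = mi_functional c I M Y"
proof -
  have "subsystem X S = subsystem Y S" if "S \<subseteq> I" for S
    using assms that by (auto simp: subsystem_def fun_eq_iff restrict_def)
  then show ?thesis unfolding mi_functional_def by (intro sum.cong) auto
qed

lemma up_sum_relabel:
  assumes c: "intricacy c" and I: "finite_index_set I" and J: "finite_index_set J"
    and \<phi>: "bij_betw \<phi> I J" and K: "K \<subseteq> I" "K \<noteq> {}"
  shows "up_sum c J (\<phi> ` K) = up_sum c I K"
proof -
  have cs: "coefficient_system c" and ex: "exchangeable c" using c by (auto simp: intricacy_def)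
  have K': "\<phi> ` K \<subseteq> J" "\<phi> ` K \<noteq> {}" using K \<phi> by (auto simp: bij_betw_def)
  have "mi_functional c I coin (coin_system K) = mi_functional c J coin (\<lambda>j. coin_system K (inv_into I \<phi> j))"
    by (rule relabel_system(2)[OF ex _ I J \<phi> system_coin]) simp
  also have "\<dots> = mi_functional c J coin (coin_system (\<phi> ` K))"
  proof (rule mi_functional_cong)
    fix j assume "j \<in> J"
    then have "inv_into I \<phi> j \<in> K \<longleftrightarrow> j \<in> \<phi> ` K"
      using \<phi> K by (auto simp: bij_betw_def inv_into_f_f subset_iff)
    then show "coin_system K (inv_into I \<phi> j) = coin_system (\<phi> ` K) j"
      by (simp add: coin_system_def fun_eq_iff)
  qed
  finally show ?thesis
    unfolding mi_functional_coin[OF cs I K] mi_functional_coin[OF cs J K'] by simp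
qed

text \<open>Adding independent constant variables indexed by \<open>J\<close> does not change the functional by weak
additivity, and by \<open>mi_functional_coin\<close> the functional determines the sum.\<close>

lemma up_sum_restrict:
  assumes c: "intricacy c" and I: "finite_index_set I" and J: "finite_index_set J"
    and IJ: "I \<inter> J = {}" and K: "K \<subseteq> I" "K \<noteq> {}"
  shows "up_sum c (I \<union> J) K = up_sum c I K"
proof -
  have cs: "coefficient_system c" and wa: "weakly_additive c" using c by (auto simp: intricacy_def)
  have IJ': "finite_index_set (I \<union> J)" using I J by (auto simp: finite_index_set_def)
  have fin: "finite (I \<union> J)" using IJ' by (simp add: finite_index_set_def)
  have K': "K \<subseteq> I \<union> J" using K by auto
  let ?P = "coin \<Otimes>\<^sub>M coin" and ?Z = "join_systems I (coin_system K) (coin_system {})"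
  note Z = join_systems_additive[OF wa order_refl I J IJ system_coin[of I K] system_coin[of J "{}"]]
  interpret coin: prob_space coin by (rule prob_space_coin)
  have "?Z i = (\<lambda>\<omega>. coin_system K i (fst \<omega>))" if "i \<in> I \<union> J" for i
    using that K IJ by (auto simp: join_systems_def coin_system_def fun_eq_iff)
  then have sub: "subsystem ?Z (I \<union> J) = (\<lambda>\<omega>. subsystem (coin_system K) (I \<union> J) (fst \<omega>))"
    by (auto simp: subsystem_def fun_eq_iff restrict_def)
  have "mi_functional c (I \<union> J) ?P ?Z = mi_functional c (I \<union> J) coin (coin_system K)"
  proof (rule same_law[OF fin Z(1) system_coin])
    show "distr ?P (configurations 2 (I \<union> J)) (subsystem ?Z (I \<union> J)) =
        distr coin (configurations 2 (I \<union> J)) (subsystem (coin_system K) (I \<union> J))"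
      using distr_distr[OF subsystem_measurable[OF fin system_coin[of "I \<union> J" K]] measurable_fst[of coin coin]]
      by (simp add: coin.distr_pair_fst comp_def sub)
  qed
  moreover have "mi_functional c J coin (coin_system {}) = 0"
    unfolding mi_functional_def by (intro sum.neutral) (auto simp: mutual_info_split system_entropy_coin)
  ultimately show ?thesis
    using Z(2) unfolding mi_functional_coin[OF cs I K] mi_functional_coin[OF cs IJ' K' K(2)] by simp
qed

text \<open>It turns out to be the \<open>k\<close>-th moment of the measure that represents \<open>c\<close>.\<close>

definition coefficient_moment :: "(nat set \<Rightarrow> nat set \<Rightarrow> real) \<Rightarrow> nat \<Rightarrow> real" where
  "coefficient_moment c k = c {1..k} {1..k}"

text \<open>Restrict to the index set \<open>K\<close>, where the only subset containing \<open>K\<close> is \<open>K\<close> itself, and relabel \<open>K\<close> as an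
initial segment. The empty set needs the normalisation of the coefficients instead.\<close>

lemma up_sum_eq_moment:
  assumes c: "intricacy c" and I: "finite_index_set I" and K: "K \<subseteq> I"
  shows "up_sum c I K = coefficient_moment c (card K)"
proof (cases "K = {}")
  case True
  have one: "(\<Sum>S\<in>Pow I. c I S) = 1" if "finite_index_set I" for I
    using c that by (auto simp: intricacy_def coefficient_system_def)
  have "{S. S \<subseteq> I} = Pow I" by auto
  then show ?thesis
    using True one[OF I] one[of "{}"] by (simp add: up_sum_def coefficient_moment_def finite_index_set_def)
next
  case False
  have finK: "finite K" and K': "finite_index_set K" and IK: "finite_index_set (I - K)"
    using I K by (auto simp: finite_index_set_def intro: finite_subset)
  have "K \<union> (I - K) = I" "K \<inter> (I - K) = {}" using K by auto
  then have "up_sum c I K = up_sum c K K"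
    using up_sum_restrict[OF c K' IK, of K] False by simp
  moreover obtain \<phi> where \<phi>: "bij_betw \<phi> K {1..card K}"
    using ex_bij_betw_finite_nat[OF finK] finK
    by (metis card_atLeastAtMost diff_Suc_1 finite_atLeastAtMost finite_same_card_bij)
  then have "up_sum c K K = up_sum c {1..card K} {1..card K}"
    using up_sum_relabel[OF c K' _ \<phi>, of K] False by (simp add: bij_betw_def)
  moreover have "{S. A \<subseteq> S \<and> S \<subseteq> A} = {A}" for A :: "nat set" by auto
  ultimately show ?thesis by (simp add: up_sum_def coefficient_moment_def)
qed

text \<open>Forgetting one index: the random subset for \<open>I\<close>, intersected with \<open>I - {j}\<close>, is the random
subset for \<open>I - {j}\<close>. Both contain a given \<open>K\<close> with the same probability, and these probabilities
determine the weights.\<close>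

lemma coefficient_marginal:
  assumes c: "intricacy c" and I: "finite_index_set I" and j: "j \<in> I" and S: "S \<subseteq> I - {j}"
  shows "c (I - {j}) S = c I S + c I (insert j S)"
proof (rule up_sums_determine[OF _ _ S])
  have I': "finite_index_set (I - {j})" and fin: "finite I"
    using I by (auto simp: finite_index_set_def)
  then show "finite (I - {j})" by simp
  fix K assume K: "K \<subseteq> I - {j}"
  let ?A = "{S. K \<subseteq> S \<and> S \<subseteq> I - {j}}"
  have A: "finite ?A" by (rule finite_subset[of _ "Pow I"]) (use fin in auto)
  have split: "{S. K \<subseteq> S \<and> S \<subseteq> I} = ?A \<union> insert j ` ?A"
  proof (intro equalityI subsetI)
    fix T assume T: "T \<in> {S. K \<subseteq> S \<and> S \<subseteq> I}"
    show "T \<in> ?A \<union> insert j ` ?A"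
    proof (cases "j \<in> T")
      case True
      then have "T = insert j (T - {j})" "T - {j} \<in> ?A" using T K by auto
      then show ?thesis by blast
    qed (use T in auto)
  qed (use j in auto)
  have "inj_on (insert j) ?A" by (rule inj_onI) auto
  then have "up_sum c I K = (\<Sum>S\<in>?A. c I S + c I (insert j S))"
    unfolding up_sum_def split using A
    by (subst sum.union_disjoint) (auto simp: sum.reindex sum.distrib)
  moreover have "up_sum c (I - {j}) K = up_sum c I K"
    using up_sum_eq_moment[OF c I', of K] up_sum_eq_moment[OF c I, of K] K
    by (metis Diff_subset order_trans)
  ultimately show "sum (c (I - {j})) ?A = (\<Sum>S\<in>?A. c I S + c I (insert j S))"
    by (simp add: up_sum_def)
qed

text \<open>Induction on the number of indices outside \<open>S\<close>: the marginal relation expresses \<open>c I S\<close> as a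
difference of two coefficients with one index fewer outside, which matches
\<open>x ^ s * (1 - x) ^ n - x ^ (s + 1) * (1 - x) ^ n = x ^ s * (1 - x) ^ (n + 1)\<close>.\<close>

lemma coefficient_from_moments:
  assumes c: "intricacy c" and \<nu>: "prob_space \<nu>" "sets \<nu> = sets (restrict_space borel {0..1::real})"
    and mom: "\<And>k. (\<integral>x. x ^ k \<partial>\<nu>) = coefficient_moment c k"
    and I: "finite_index_set I" and S: "S \<subseteq> I"
  shows "c I S = (\<integral>x. x ^ card S * (1 - x) ^ (card I - card S) \<partial>\<nu>)"
proof -
  have "\<lbrakk>finite_index_set I; S \<subseteq> I; card (I - S) = n\<rbrakk> \<Longrightarrow>
      c I S = (\<integral>x. x ^ card S * (1 - x) ^ n \<partial>\<nu>)" for n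
  proof (induction n arbitrary: I S)
    case 0
    then have "S = I" by (auto simp: finite_index_set_def)
    moreover have "{T. I \<subseteq> T \<and> T \<subseteq> I} = {I}" by auto
    ultimately show ?case
      using up_sum_eq_moment[OF c 0(1), of I] mom by (simp add: up_sum_def)
  next
    case (Suc n)
    have fin: "finite I" "finite S" using Suc.prems by (auto simp: finite_index_set_def intro: finite_subset)
    obtain j where j: "j \<in> I - S" using Suc.prems(3) by (metis card.empty ex_in_conv nat.distinct(1))
    have I': "finite_index_set (I - {j})" using Suc.prems(1) by (auto simp: finite_index_set_def)
    have cards: "card (I - {j} - S) = n" "card (I - insert j S) = n"
      using j Suc.prems(3) fin
      by (metis Diff_insert Diff_insert2 card_Diff_singleton diff_Suc_1)+
    have "S \<subseteq> I - {j}" "j \<in> I" using j Suc.prems(2) by auto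
    then have "c I S = c (I - {j}) S - c I (insert j S)"
      using coefficient_marginal[OF c Suc.prems(1), of j S] by simp
    also have "\<dots> = (\<integral>x. x ^ card S * (1 - x) ^ n \<partial>\<nu>) - (\<integral>x. x ^ Suc (card S) * (1 - x) ^ n \<partial>\<nu>)"
      using Suc.IH[OF I' _ cards(1)] Suc.IH[OF Suc.prems(1) _ cards(2)] Suc.prems(2) j fin by auto
    also have "\<dots> = (\<integral>x. x ^ card S * (1 - x) ^ n - x ^ Suc (card S) * (1 - x) ^ n \<partial>\<nu>)"
      by (intro Bochner_Integration.integral_diff[symmetric] integrable_unit_interval \<nu>)
    also have "\<dots> = (\<integral>x. x ^ card S * (1 - x) ^ Suc n \<partial>\<nu>)"
      by (simp add: algebra_simps)
    finally show ?case .
  qed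
  from this[OF I S refl] show ?thesis
    using card_Diff_subset[of S I] I S by (auto simp: finite_index_set_def finite_subset)
qed

section \<open>The symmetric measure of an intricacy\<close>

definition random_subset :: "(nat set \<Rightarrow> nat set \<Rightarrow> real) \<Rightarrow> nat \<Rightarrow> nat set pmf" where
  "random_subset c n = embed_pmf (\<lambda>S. if S \<subseteq> {1..n} then c {1..n} S else 0)"

lemma pmf_random_subset:
  assumes c: "coefficient_system c"
  shows "pmf (random_subset c n) S = (if S \<subseteq> {1..n} then c {1..n} S else 0)"
  unfolding random_subset_def
proof (rule pmf_embed_pmf)
  let ?f = "\<lambda>S. if S \<subseteq> {1..n} then c {1..n} S else 0"
  have I: "finite_index_set {1..n}" by simp
  show nn: "0 \<le> ?f S" for S using c I unfolding coefficient_system_def by simp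
  have "(\<integral>\<^sup>+S. ennreal (?f S) \<partial>count_space UNIV) = (\<Sum>S\<in>Pow {1..n}. ennreal (?f S))"
    by (rule nn_integral_count_space') auto
  also have "\<dots> = ennreal (\<Sum>S\<in>Pow {1..n}. ?f S)" by (rule sum_ennreal) (rule nn)
  also have "(\<Sum>S\<in>Pow {1..n}. ?f S) = (\<Sum>S\<in>Pow {1..n}. c {1..n} S)" by (rule sum.cong) auto
  also have "\<dots> = 1" using c I unfolding coefficient_system_def by blast
  finally show "(\<integral>\<^sup>+S. ennreal (?f S) \<partial>count_space UNIV) = 1" by simp
qed

text \<open>Double counting of the pairs \<open>K \<subseteq> S\<close> with \<open>card K = j\<close>: each of the \<open>n choose j\<close> sets \<open>K\<close> is
contained in the random subset with the same probability.\<close>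

lemma random_subset_factorial_moment:
  assumes c: "intricacy c"
  shows "measure_pmf.expectation (random_subset c n) (\<lambda>S. real (card S choose j)) =
    real (n choose j) * coefficient_moment c j"
proof -
  have cs: "coefficient_system c" using c by (simp add: intricacy_def)
  let ?I = "{1..n}" and ?J = "{K. K \<subseteq> {1..n} \<and> card K = j}"
  have finJ: "finite ?J" by (rule finite_subset[of _ "Pow ?I"]) auto
  have choose: "real (card S choose j) = (\<Sum>K\<in>?J. if K \<subseteq> S then 1 else 0)" if "S \<in> Pow ?I" for S
  proof -
    have fin: "finite S" using that by (auto intro: finite_subset)
    have "{K. K \<subseteq> S \<and> card K = j} = {K \<in> ?J. K \<subseteq> S}" using that by auto
    then have "card S choose j = card {K \<in> ?J. K \<subseteq> S}" using n_subsets[OF fin, of j] by simp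
    then show ?thesis using finJ by (simp add: sum.inter_filter[symmetric])
  qed
  have "measure_pmf.expectation (random_subset c n) (\<lambda>S. real (card S choose j)) =
      (\<Sum>S\<in>Pow ?I. real (card S choose j) * pmf (random_subset c n) S)"
    by (rule integral_measure_pmf_real) (auto simp: set_pmf_eq pmf_random_subset[OF cs] split: if_splits)
  also have "\<dots> = (\<Sum>S\<in>Pow ?I. \<Sum>K\<in>?J. if K \<subseteq> S then c ?I S else 0)"
    by (intro sum.cong refl)
      (auto simp: pmf_random_subset[OF cs] choose sum_distrib_right intro!: sum.cong)
  also have "\<dots> = (\<Sum>K\<in>?J. up_sum c ?I K)"
    by (subst sum.swap) (intro sum.cong refl up_sum_Pow[symmetric] finite_atLeastAtMost)
  also have "\<dots> = (\<Sum>K\<in>?J. coefficient_moment c j)"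
    using up_sum_eq_moment[OF c] by (intro sum.cong refl) auto
  also have "\<dots> = real (n choose j) * coefficient_moment c j"
    using n_subsets[of ?I j] by simp
  finally show ?thesis .
qed

text \<open>The moment problem provides a measure with the right moments, hence with the right coefficients;
its symmetry under \<open>x \<mapsto> 1 - x\<close> follows from \<open>c I {} = c I I\<close>, as the reflected measure has
the moments \<open>c {1..k} {}\<close>.\<close>

lemma represents_unique_exists:
  assumes c: "intricacy c"
  shows "\<exists>!\<nu>. represents \<nu> c"
proof (rule ex_ex1I)
  have cs: "coefficient_system c" using c by (simp add: intricacy_def)
  define p where "p n = map_pmf card (random_subset c n)" for n
  have supp: "set_pmf (p n) \<subseteq> {..n}" for n
  proof
    fix k assume "k \<in> set_pmf (p n)"
    then obtain S where S: "k = card S" "S \<in> set_pmf (random_subset c n)" by (auto simp: p_def)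
    then have "S \<subseteq> {1..n}"
      by (auto simp: set_pmf_eq pmf_random_subset[OF cs] split: if_splits)
    with S show "k \<in> {..n}" using card_mono[of "{1..n}" S] by simp
  qed
  have "measure_pmf.expectation (p n) (\<lambda>k. real (k choose j)) = real (n choose j) * coefficient_moment c j" for n j
    using random_subset_factorial_moment[OF c] by (simp add: p_def)
  from moment_measure_exists[of p "coefficient_moment c", OF supp this]
  obtain \<nu> where \<nu>: "prob_space \<nu>" "sets \<nu> = sets (restrict_space borel {0..1::real})"
    and mom: "\<And>k. (\<integral>x. x ^ k \<partial>\<nu>) = coefficient_moment c k" by blast
  interpret prob_space \<nu> by fact
  note rep = coefficient_from_moments[OF c \<nu> mom]
  have pm: "(\<lambda>x. x ^ k) \<in> borel_measurable \<nu>" for k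
    by (rule unit_interval_measure(2)[OF \<nu>(2)]) simp
  have "(\<lambda>x::real. 1 - x) \<in> measurable (restrict_space borel {0..1}) (restrict_space borel {0..1})"
    by (intro measurable_restrict_space2 measurable_restrict_space1) (auto simp: space_restrict_space)
  then have flip: "(\<lambda>x. 1 - x) \<in> measurable \<nu> \<nu>"
    using \<nu>(2) by (simp cong: measurable_cong_sets)
  have "distr \<nu> \<nu> (\<lambda>x. 1 - x) = \<nu>"
  proof (rule moments_determine[OF prob_space_distr[OF flip] _ \<nu>])
    fix k
    have I: "finite_index_set {1..k}" by simp
    have "(\<integral>x. x ^ k \<partial>distr \<nu> \<nu> (\<lambda>x. 1 - x)) = (\<integral>x. (1 - x) ^ k \<partial>\<nu>)"
      by (rule integral_distr[OF flip pm])
    also have "\<dots> = c {1..k} {}" using rep[OF I, of "{}"] by simp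
    also have "\<dots> = c {1..k} ({1..k} - {})"
      using cs I unfolding coefficient_system_def by (metis empty_subsetI)
    also have "\<dots> = (\<integral>x. x ^ k \<partial>\<nu>)" by (simp add: mom coefficient_moment_def)
    finally show "(\<integral>x. x ^ k \<partial>distr \<nu> \<nu> (\<lambda>x. 1 - x)) = (\<integral>x. x ^ k \<partial>\<nu>)" .
  qed (simp add: \<nu>(2))
  then show "\<exists>\<nu>. represents \<nu> c"
    using \<nu> rep unfolding represents_def by blast
next
  fix \<nu>1 \<nu>2 assume 1: "represents \<nu>1 c" and 2: "represents \<nu>2 c"
  have prob: "prob_space \<nu>" "sets \<nu> = sets (restrict_space borel {0..1})" if "represents \<nu> c" for \<nu>
    using that by (simp_all add: represents_def)
  have mom: "(\<integral>x. x ^ k \<partial>\<nu>) = c {1..k} {1..k}" if "represents \<nu> c" for \<nu> k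
  proof -
    have "finite_index_set {1..k}" by simp
    then have "c {1..k} {1..k} = (\<integral>x. x ^ card {1..k} * (1 - x) ^ (card {1..k} - card {1..k}) \<partial>\<nu>)"
      using that unfolding represents_def by blast
    then show ?thesis by simp
  qed
  have "(\<integral>x. x ^ k \<partial>\<nu>1) = (\<integral>x. x ^ k \<partial>\<nu>2)" for k
    by (simp only: mom[OF 1] mom[OF 2])
  then show "\<nu>1 = \<nu>2"
    by (rule moments_determine[OF prob[OF 1] prob[OF 2]])
qed

lemma intricacy_measure_represents:
  "intricacy c \<Longrightarrow> represents (intricacy_measure c) c"
  unfolding intricacy_measure_def by (rule theI'[OF represents_unique_exists])

lemma kappa_eq_coefficient:
  assumes c: "intricacy c" shows "kappa c = 2 * c {1..2} {1}"
proof -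
  have I: "finite_index_set {1..2}" by simp
  have S: "{1} \<subseteq> {1..2::nat}" by auto
  have "c {1..2} {1} = (\<integral>x. x ^ card {1::nat} * (1 - x) ^ (card {1..2::nat} - card {1::nat}) \<partial>intricacy_measure c)"
    using intricacy_measure_represents[OF c] I S unfolding represents_def by blast
  then show ?thesis by (simp add: kappa_def)
qed

text \<open>Some coefficient with \<open>S\<close> proper and nonempty is positive, and its integrand
\<open>x ^ s * (1 - x) ^ t\<close> with \<open>s, t \<ge> 1\<close> is dominated by \<open>x * (1 - x)\<close>.\<close>

lemma kappa_pos:
  assumes c: "intricacy c" and nn: "non_null c"
  shows "kappa c > 0"
proof -
  let ?\<nu> = "intricacy_measure c"
  have rep: "represents ?\<nu> c" by (rule intricacy_measure_represents[OF c])
  then have \<nu>: "prob_space ?\<nu>" "sets ?\<nu> = sets (restrict_space borel {0..1})"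
    by (auto simp: represents_def)
  obtain I S where IS: "finite_index_set I" "S \<subseteq> I" "S \<noteq> {}" "S \<noteq> I" "c I S \<noteq> 0"
    using nn by (auto simp: non_null_def)
  have fin: "finite I" using IS by (simp add: finite_index_set_def)
  define s t where "s = card S" and "t = card I - card S"
  have s: "s \<ge> 1" using IS fin by (auto simp: s_def Suc_le_eq card_gt_0_iff intro: finite_subset)
  have "S \<subset> I" using IS by auto
  then have t: "t \<ge> 1" using psubset_card_mono[OF fin] by (simp add: t_def Suc_le_eq)
  have "c I S \<ge> 0" using c IS unfolding intricacy_def coefficient_system_def by blast
  then have "0 < c I S" using IS by simp
  also have "c I S = (\<integral>x. x ^ s * (1 - x) ^ t \<partial>?\<nu>)"
    using rep IS unfolding represents_def s_def t_def by blast
  also have "\<dots> \<le> (\<integral>x. x * (1 - x) \<partial>?\<nu>)"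
  proof (rule integral_mono_AE)
    note int = integrable_unit_interval[OF \<nu>]
    show "integrable ?\<nu> (\<lambda>x. x ^ s * (1 - x) ^ t)" by (rule int)
    show "integrable ?\<nu> (\<lambda>x. x * (1 - x))" using int[of 1 1] by simp
    show "AE x in ?\<nu>. x ^ s * (1 - x) ^ t \<le> x * (1 - x)"
    proof (rule AE_I2)
      fix x assume "x \<in> space ?\<nu>"
      then have x: "0 \<le> x" "x \<le> 1" by (auto simp: unit_interval_measure(1)[OF \<nu>(2)])
      have "x ^ s \<le> x" "(1 - x) ^ t \<le> 1 - x"
        using power_decreasing[of 1 s x] power_decreasing[of 1 t "1 - x"] x s t by auto
      then show "x ^ s * (1 - x) ^ t \<le> x * (1 - x)"
        using x by (intro mult_mono) auto
    qed
  qed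
  finally show ?thesis by (simp add: kappa_def)
qed

section \<open>The limit theorem\<close>

text \<open>The lower bound of the theorem at \<open>N = 2\<close>; it passes to the limit because the limit dominates
the average at every \<open>N\<close>.\<close>

lemma max_intricacy_at_two:
  assumes c: "intricacy c" and d: "d \<ge> 2" and x: "x \<in> {0..1}"
  shows "min x (1 - x) * kappa c * ln (real d) * 2 \<le> max_intricacy_at c d 2 x"
proof -
  obtain \<mu> where \<mu>: "\<mu> \<in> laws d {1..2}" "entropy_law {1..2} \<mu> = x * real 2 * ln (real d)"
    "mi_functional_law c {1..2} \<mu> = 2 * c {1..2} {1} * (2 * min x (1 - x) * ln (real d))"
    using two_coordinate_law[OF c d x] by auto
  have "min x (1 - x) * kappa c * ln (real d) * 2 = mi_functional_law c {1..2} \<mu>"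
    unfolding \<mu>(3) kappa_eq_coefficient[OF c] by simp
  also have "\<dots> \<le> max_intricacy_at c d 2 x" by (rule max_intricacy_at_upper[OF c d \<mu>(1,2)])
  finally show ?thesis .
qed

lemma max_intricacy_le:
  assumes c: "intricacy c" and d: "d \<ge> 2"
  shows "max_intricacy c d N \<le> ln (real d) / 2 * real N"
  unfolding max_intricacy_def
proof (rule cSUP_least)
  show "laws d {1..N} \<noteq> {}" using exists_law_entropy[OF c d, of 0 N] d by auto
qed (use c law_bounds(2)[OF _ d] in \<open>auto simp: intricacy_def\<close>)

theorem theorem1p3:
  fixes c :: "nat set \<Rightarrow> nat set \<Rightarrow> real" and d :: nat
  assumes "intricacy c" and "non_null c" and "d \<ge> 2"
  shows
    "convergent (\<lambda>N. max_intricacy c d N / real N) \<and>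
     (\<forall>x\<in>{0..1}. convergent (\<lambda>N. max_intricacy_at c d N x / real N)) \<and>
     kappa c > 0 \<and>
     (\<forall>x\<in>{0..1}.
        min x (1 - x) * kappa c \<le> limit_intricacy_at c d x / ln (real d) \<and>
        limit_intricacy_at c d x / ln (real d) \<le> limit_intricacy c d / ln (real d) \<and>
        limit_intricacy c d / ln (real d) \<le> 1 / 2) \<and>
     (\<forall>\<delta> x. (\<forall>N\<ge>1. \<delta> N \<ge> 0) \<longrightarrow> \<delta> \<longlonglongrightarrow> 0 \<longrightarrow> x \<in> {0..1} \<longrightarrow>
        (\<lambda>N. max_intricacy_near c d N x (\<delta> N) / real N) \<longlonglongrightarrow> limit_intricacy_at c d x)"
proof -
  note c = assms(1) and d = assms(3)
  have lnd: "0 < ln (real d)" using d by simp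
  obtain L where L: "(\<lambda>N. max_intricacy c d N / real N) \<longlonglongrightarrow> L"
    using max_intricacy_limit[OF c d] by auto
  have limL: "limit_intricacy c d = L" unfolding limit_intricacy_def by (rule limI[OF L])
  have at: "(\<lambda>N. max_intricacy_at c d N x / real N) \<longlonglongrightarrow> limit_intricacy_at c d x"
    "\<And>N. max_intricacy_at c d N x \<le> limit_intricacy_at c d x * real N" if x: "x \<in> {0..1}" for x
  proof -
    obtain L' where L': "(\<lambda>N. max_intricacy_at c d N x / real N) \<longlonglongrightarrow> L'"
      "\<And>N. max_intricacy_at c d N x \<le> L' * real N"
      using max_intricacy_at_limit[OF c d x] by auto
    then have "limit_intricacy_at c d x = L'" unfolding limit_intricacy_at_def by (intro limI)
    with L' show "(\<lambda>N. max_intricacy_at c d N x / real N) \<longlonglongrightarrow> limit_intricacy_at c d x"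
      "\<And>N. max_intricacy_at c d N x \<le> limit_intricacy_at c d x * real N" by auto
  qed
  have bounds: "min x (1 - x) * kappa c \<le> limit_intricacy_at c d x / ln (real d)"
    "limit_intricacy_at c d x / ln (real d) \<le> limit_intricacy c d / ln (real d)"
    "limit_intricacy c d / ln (real d) \<le> 1 / 2" if x: "x \<in> {0..1}" for x
  proof -
    have "min x (1 - x) * kappa c * ln (real d) \<le> limit_intricacy_at c d x"
      using max_intricacy_at_two[OF c d x] at(2)[OF x, of 2] by simp
    then show "min x (1 - x) * kappa c \<le> limit_intricacy_at c d x / ln (real d)"
      using lnd by (simp add: pos_le_divide_eq)
    have "limit_intricacy_at c d x \<le> L"
      by (rule LIMSEQ_le[OF at(1)[OF x] L])
        (auto intro!: exI[of _ 0] divide_right_mono max_intricacy_at_le[OF c d x])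
    then show "limit_intricacy_at c d x / ln (real d) \<le> limit_intricacy c d / ln (real d)"
      using lnd unfolding limL by (intro divide_right_mono) auto
    have "L \<le> ln (real d) / 2"
    proof (rule LIMSEQ_le_const2[OF L], intro exI[of _ 1] allI impI)
      fix N :: nat assume "1 \<le> N"
      then show "max_intricacy c d N / real N \<le> ln (real d) / 2"
        using max_intricacy_le[OF c d, of N] by (simp add: pos_divide_le_eq)
    qed
    then show "limit_intricacy c d / ln (real d) \<le> 1 / 2"
      using lnd unfolding limL by (simp add: pos_divide_le_eq)
  qed
  have near: "(\<lambda>N. max_intricacy_near c d N x (\<delta> N) / real N) \<longlonglongrightarrow> limit_intricacy_at c d x"
    if "\<forall>N\<ge>1. \<delta> N \<ge> 0" "\<delta> \<longlonglongrightarrow> 0" "x \<in> {0..1}" for \<delta> x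
    using that by (intro max_intricacy_near_limit[OF c d _ _ _ at]) auto
  show ?thesis
    using convergentI[OF L] convergentI[OF at(1)] kappa_pos[OF c assms(2)] bounds near by blast
qed

end
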